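(* Let $(M,\omega)$ be a compact connected symplectic manifold and let $\widetilde\omega$ be the induced weakly symplectic form on the path space $\mathcal{P}M$. Then $\widetilde\omega$ is the sum of the pull-back of $\omega$ by evaluation at $0$ and a globally defined exact form: $$\widetilde\omega=\mathrm{ev}_0^*\omega+\mathrm{d}\lambda,$$ where $\lambda$ is the global $1$-form on $\mathcal{P}M$ given by $$\bigl(\lambda(v)\bigr)(\gamma)=\int_0^1\left(\int_0^t\omega\bigl(\dot\gamma(\tau),d\,\mathrm{ev}_\tau(v(\gamma))\bigr)\,d\tau\right)dt$$ for any vector field $v$ on $\mathcal{P}M$.
   Context: $\mathcal{P}M$ is the space of all smooth maps $\gamma:[0,1]\to M$, with its standard (Chen) differentiable structure and exterior derivative $\mathrm{d}$; the tangent space at $\gamma$ is the space of smooth vector fields along $\gamma$. $\mathrm{ev}_t:\mathcal{P}M\to M$ is $\mathrm{ev}_t(\gamma)=\gamma(t)$, so $d\,\mathrm{ev}_t(v(\gamma))=(v(\gamma))(t)$. The form $\widetilde\omega$ is $$\bigl(\widetilde\omega(v_1,v_2)\bigr)(\gamma)=\int_0^1\omega\bigl(d\,\mathrm{ev}_t(v_1(\gamma)),d\,\mathrm{ev}_t(v_2(\gamma))\bigr)\,dt.$$ *)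

theory Defs
  imports "HOL-Analysis.Analysis"
begin

section \<open>Smoothness on regions with boundary\<close>

text \<open>
  Only two kinds of sets \<open>S\<close> occur below: open sets, and relatively open subsets of convex sets with
  nonempty interior (for instance \<open>U \<times> {0..1}\<close>).  On both, the derivative within \<open>S\<close> is unique, so that
  \<^const>\<open>frechet_derivative\<close> picks the only candidate; at boundary points it is the one-sided derivative.
\<close>

fun Ck_on :: "nat \<Rightarrow> 'a::real_normed_vector set \<Rightarrow> ('a \<Rightarrow> 'b::real_normed_vector) \<Rightarrow> bool" where
  "Ck_on 0 S f \<longleftrightarrow> continuous_on S f"
| "Ck_on (Suc k) S f \<longleftrightarrow>
     (\<forall>x\<in>S. f differentiable (at x within S)) \<and>
     (\<forall>v. Ck_on k S (\<lambda>x. frechet_derivative f (at x within S) v))"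

definition smooth_on :: "'a::real_normed_vector set \<Rightarrow> ('a \<Rightarrow> 'b::real_normed_vector) \<Rightarrow> bool" where
  "smooth_on S f \<longleftrightarrow> (\<forall>k. Ck_on k S f)"


section \<open>Smooth manifolds and tangent vectors\<close>

text \<open>A chart is a pair of its domain and its coordinate map; the values of the coordinate map outside
  the domain are irrelevant.\<close>

type_synonym ('m, 'e) chart = "'m set \<times> ('m \<Rightarrow> 'e)"

definition smooth_atlas :: "'m topology \<Rightarrow> ('m, 'e::euclidean_space) chart set \<Rightarrow> bool" where
  "smooth_atlas X A \<longleftrightarrow>
     (\<forall>(D, c)\<in>A. openin X D \<and> open (c ` D) \<and>
        homeomorphic_map (subtopology X D) (top_of_set (c ` D)) c) \<and>
     (\<Union>(D, c)\<in>A. D) = topspace X \<and>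
     (\<forall>(D, c)\<in>A. \<forall>(D', c')\<in>A. smooth_on (c ` (D \<inter> D')) (c' \<circ> inv_into D c))"

definition smooth_manifold :: "'m topology \<Rightarrow> ('m, 'e::euclidean_space) chart set \<Rightarrow> bool" where
  "smooth_manifold X A \<longleftrightarrow> Hausdorff_space X \<and> second_countable X \<and> smooth_atlas X A"

definition charts_at :: "('m, 'e) chart set \<Rightarrow> 'm \<Rightarrow> ('m, 'e) chart set" where
  "charts_at A p = {c \<in> A. p \<in> fst c}"

definition chart_inv :: "('m, 'e) chart \<Rightarrow> 'e \<Rightarrow> 'm" where
  "chart_inv c = inv_into (fst c) (snd c)"

definition jac :: "('m, 'e::euclidean_space) chart \<Rightarrow> ('m, 'e) chart \<Rightarrow> 'm \<Rightarrow> 'e \<Rightarrow> 'e" where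
  "jac c c' p = frechet_derivative (snd c' \<circ> chart_inv c) (at (snd c p))"

text \<open>
  A tangent vector at \<open>p\<close> is given by its components \<open>v c\<close> in all charts \<open>c\<close> around \<open>p\<close>, which have to
  transform by the Jacobians of the coordinate changes; the irrelevant components are fixed to be 0.
\<close>

type_synonym ('m, 'e) tvec = "('m, 'e) chart \<Rightarrow> 'e"

definition tangent_space :: "('m, 'e::euclidean_space) chart set \<Rightarrow> 'm \<Rightarrow> ('m, 'e) tvec set" where
  "tangent_space A p =
     {v. (\<forall>c. c \<notin> charts_at A p \<longrightarrow> v c = 0) \<and>
         (\<forall>c\<in>charts_at A p. \<forall>c'\<in>charts_at A p. v c' = jac c c' p (v c))}"

text \<open>The tangent vector at \<open>p\<close> whose component in the chart \<open>c\<close> is \<open>a\<close>.\<close>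

definition coord_vec ::
  "('m, 'e::euclidean_space) chart set \<Rightarrow> ('m, 'e) chart \<Rightarrow> 'm \<Rightarrow> 'e \<Rightarrow> ('m, 'e) tvec" where
  "coord_vec A c p a = (\<lambda>c'. if c' \<in> charts_at A p then jac c c' p a else 0)"

definition tvec_comb ::
  "real \<Rightarrow> ('m, 'e::euclidean_space) tvec \<Rightarrow> real \<Rightarrow> ('m, 'e) tvec \<Rightarrow> ('m, 'e) tvec" where
  "tvec_comb r v s w = (\<lambda>c. r *\<^sub>R v c + s *\<^sub>R w c)"

definition smooth_into ::
  "'m topology \<Rightarrow> ('m, 'e::euclidean_space) chart set \<Rightarrow> 'a::real_normed_vector set \<Rightarrow> ('a \<Rightarrow> 'm) \<Rightarrow> bool"
  where
  "smooth_into X A S g \<longleftrightarrow>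
     continuous_map (top_of_set S) X g \<and> (\<forall>(D, c)\<in>A. smooth_on (S \<inter> g -` D) (c \<circ> g))"

text \<open>The differential at \<open>x\<close> of a smooth map \<open>g\<close> from \<open>S\<close> into the manifold.\<close>

definition tangent_map ::
  "('m, 'e::euclidean_space) chart set \<Rightarrow> 'a::real_normed_vector set \<Rightarrow> ('a \<Rightarrow> 'm) \<Rightarrow> 'a \<Rightarrow> 'a \<Rightarrow> ('m, 'e) tvec"
  where
  "tangent_map A S g x u =
     (\<lambda>c. if c \<in> charts_at A (g x) then frechet_derivative (snd c \<circ> g) (at x within S) u else 0)"


section \<open>Symplectic forms\<close>

text \<open>The argument \<open>comb\<close> forms linear combinations \<open>r v + s w\<close> in the vector space \<open>T\<close>.\<close>

definition linear_form_on ::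
  "(real \<Rightarrow> 'v \<Rightarrow> real \<Rightarrow> 'v \<Rightarrow> 'v) \<Rightarrow> 'v set \<Rightarrow> ('v \<Rightarrow> real) \<Rightarrow> bool" where
  "linear_form_on comb T l \<longleftrightarrow>
     (\<forall>v\<in>T. \<forall>w\<in>T. \<forall>r s. l (comb r v s w) = r * l v + s * l w)"

definition alt_bilinear_on ::
  "(real \<Rightarrow> 'v \<Rightarrow> real \<Rightarrow> 'v \<Rightarrow> 'v) \<Rightarrow> 'v set \<Rightarrow> ('v \<Rightarrow> 'v \<Rightarrow> real) \<Rightarrow> bool" where
  "alt_bilinear_on comb T B \<longleftrightarrow>
     (\<forall>v\<in>T. B v v = 0) \<and>
     (\<forall>w\<in>T. linear_form_on comb T (\<lambda>v. B v w)) \<and>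
     (\<forall>v\<in>T. linear_form_on comb T (\<lambda>w. B v w))"

text \<open>The coefficients of a 2-form on the manifold in the chart \<open>c\<close>.\<close>

definition chart_form ::
  "('m, 'e::euclidean_space) chart set \<Rightarrow> ('m \<Rightarrow> ('m, 'e) tvec \<Rightarrow> ('m, 'e) tvec \<Rightarrow> real) \<Rightarrow>
   ('m, 'e) chart \<Rightarrow> 'e \<Rightarrow> 'e \<Rightarrow> 'e \<Rightarrow> real" where
  "chart_form A \<omega> c z a b =
     \<omega> (chart_inv c z) (coord_vec A c (chart_inv c z) a) (coord_vec A c (chart_inv c z) b)"

definition smooth_2form ::
  "'m topology \<Rightarrow> ('m, 'e::euclidean_space) chart set \<Rightarrow>
   ('m \<Rightarrow> ('m, 'e) tvec \<Rightarrow> ('m, 'e) tvec \<Rightarrow> real) \<Rightarrow> bool" where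
  "smooth_2form X A \<omega> \<longleftrightarrow>
     (\<forall>p\<in>topspace X. alt_bilinear_on tvec_comb (tangent_space A p) (\<omega> p)) \<and>
     (\<forall>c\<in>A. \<forall>a b. smooth_on (snd c ` fst c) (\<lambda>z. chart_form A \<omega> c z a b))"

text \<open>The exterior derivative vanishes; it is evaluated in each chart on constant vector fields.\<close>

definition closed_2form ::
  "('m, 'e::euclidean_space) chart set \<Rightarrow> ('m \<Rightarrow> ('m, 'e) tvec \<Rightarrow> ('m, 'e) tvec \<Rightarrow> real) \<Rightarrow> bool" where
  "closed_2form A \<omega> \<longleftrightarrow>
     (\<forall>c\<in>A. \<forall>z\<in>snd c ` fst c. \<forall>u v w.
        frechet_derivative (\<lambda>z. chart_form A \<omega> c z v w) (at z) u
      - frechet_derivative (\<lambda>z. chart_form A \<omega> c z u w) (at z) v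
      + frechet_derivative (\<lambda>z. chart_form A \<omega> c z u v) (at z) w = 0)"

definition nondegenerate_2form ::
  "'m topology \<Rightarrow> ('m, 'e::euclidean_space) chart set \<Rightarrow>
   ('m \<Rightarrow> ('m, 'e) tvec \<Rightarrow> ('m, 'e) tvec \<Rightarrow> real) \<Rightarrow> bool" where
  "nondegenerate_2form X A \<omega> \<longleftrightarrow>
     (\<forall>p\<in>topspace X. \<forall>v\<in>tangent_space A p. (\<forall>w\<in>tangent_space A p. \<omega> p v w = 0) \<longrightarrow> v = (\<lambda>_. 0))"

definition symplectic_manifold ::
  "'m topology \<Rightarrow> ('m, 'e::euclidean_space) chart set \<Rightarrow>
   ('m \<Rightarrow> ('m, 'e) tvec \<Rightarrow> ('m, 'e) tvec \<Rightarrow> real) \<Rightarrow> bool" where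
  "symplectic_manifold X A \<omega> \<longleftrightarrow>
     smooth_manifold X A \<and> smooth_2form X A \<omega> \<and> closed_2form A \<omega> \<and> nondegenerate_2form X A \<omega>"


section \<open>The path space and its differential forms\<close>

definition path_space ::
  "'m topology \<Rightarrow> ('m, 'e::euclidean_space) chart set \<Rightarrow> (real \<Rightarrow> 'm) set" where
  "path_space X A = {\<gamma> \<in> extensional {0..1}. smooth_into X A {0..1} \<gamma>}"

definition velocity ::
  "('m, 'e::euclidean_space) chart set \<Rightarrow> (real \<Rightarrow> 'm) \<Rightarrow> real \<Rightarrow> ('m, 'e) tvec" where
  "velocity A \<gamma> t = tangent_map A {0..1} \<gamma> t 1"

text \<open>The tangent space of the path space at \<open>\<gamma>\<close>: the smooth vector fields along \<open>\<gamma>\<close>, extended by 0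
  outside the unit interval.\<close>

type_synonym ('m, 'e) path_tvec = "real \<Rightarrow> ('m, 'e) tvec"

definition path_tangent ::
  "('m, 'e::euclidean_space) chart set \<Rightarrow> (real \<Rightarrow> 'm) \<Rightarrow> ('m, 'e) path_tvec set" where
  "path_tangent A \<gamma> =
     {V. (\<forall>t. t \<notin> {0..1} \<longrightarrow> V t = (\<lambda>_. 0)) \<and>
         (\<forall>t\<in>{0..1}. V t \<in> tangent_space A (\<gamma> t)) \<and>
         (\<forall>c\<in>A. smooth_on ({0..1} \<inter> \<gamma> -` fst c) (\<lambda>t. V t c))}"

definition path_tvec_comb ::
  "real \<Rightarrow> ('m, 'e::euclidean_space) path_tvec \<Rightarrow> real \<Rightarrow> ('m, 'e) path_tvec \<Rightarrow> ('m, 'e) path_tvec" where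
  "path_tvec_comb r V s W = (\<lambda>t. tvec_comb r (V t) s (W t))"

text \<open>Chen's plots: maps from a convex region \<open>U\<close> to the path space whose adjoint is smooth on
  \<open>U \<times> {0..1}\<close>.\<close>

definition path_plot ::
  "'m topology \<Rightarrow> ('m, 'e::euclidean_space) chart set \<Rightarrow>
   'u::euclidean_space set \<Rightarrow> ('u \<Rightarrow> real \<Rightarrow> 'm) \<Rightarrow> bool" where
  "path_plot X A U \<phi> \<longleftrightarrow>
     convex U \<and> interior U \<noteq> {} \<and> (\<forall>x\<in>U. \<phi> x \<in> path_space X A) \<and>
     smooth_into X A (U \<times> {0..1}) (\<lambda>(x, t). \<phi> x t)"

definition plot_deriv ::
  "('m, 'e::euclidean_space) chart set \<Rightarrow> 'u::euclidean_space set \<Rightarrow> ('u \<Rightarrow> real \<Rightarrow> 'm) \<Rightarrow>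
   'u \<Rightarrow> 'u \<Rightarrow> ('m, 'e) path_tvec" where
  "plot_deriv A U \<phi> x u =
     (\<lambda>t. if t \<in> {0..1} then tangent_map A U (\<lambda>y. \<phi> y t) x u else (\<lambda>_. 0))"

type_synonym ('m, 'e) path_form1 = "(real \<Rightarrow> 'm) \<Rightarrow> ('m, 'e) path_tvec \<Rightarrow> real"
type_synonym ('m, 'e) path_form2 =
  "(real \<Rightarrow> 'm) \<Rightarrow> ('m, 'e) path_tvec \<Rightarrow> ('m, 'e) path_tvec \<Rightarrow> real"

definition plot_pullback1 ::
  "('m, 'e::euclidean_space) chart set \<Rightarrow> 'u::euclidean_space set \<Rightarrow> ('u \<Rightarrow> real \<Rightarrow> 'm) \<Rightarrow>
   ('m, 'e) path_form1 \<Rightarrow> 'u \<Rightarrow> 'u \<Rightarrow> real" where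
  "plot_pullback1 A U \<phi> \<alpha> x u = \<alpha> (\<phi> x) (plot_deriv A U \<phi> x u)"

definition plot_pullback2 ::
  "('m, 'e::euclidean_space) chart set \<Rightarrow> 'u::euclidean_space set \<Rightarrow> ('u \<Rightarrow> real \<Rightarrow> 'm) \<Rightarrow>
   ('m, 'e) path_form2 \<Rightarrow> 'u \<Rightarrow> 'u \<Rightarrow> 'u \<Rightarrow> real" where
  "plot_pullback2 A U \<phi> \<beta> x u v = \<beta> (\<phi> x) (plot_deriv A U \<phi> x u) (plot_deriv A U \<phi> x v)"

text \<open>
  Differential forms on the path space in the sense of Chen: their pullbacks along all plots are
  smooth.  The dimension of the plots is the dimension of the type \<open>'u\<close>; a statement about all plots has
  to be made for an arbitrary type \<open>'u\<close>.  Compatibility of the pullbacks with a change of plots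
  is automatic, because the forms are given as functions of tangent vectors.
\<close>

definition path_1form ::
  "'m topology \<Rightarrow> ('m, 'e::euclidean_space) chart set \<Rightarrow> 'u::euclidean_space itself \<Rightarrow>
   ('m, 'e) path_form1 \<Rightarrow> bool" where
  "path_1form X A TU \<alpha> \<longleftrightarrow>
     (\<forall>\<gamma>\<in>path_space X A. linear_form_on path_tvec_comb (path_tangent A \<gamma>) (\<alpha> \<gamma>)) \<and>
     (\<forall>(U :: 'u set) \<phi>. path_plot X A U \<phi> \<longrightarrow>
        (\<forall>u. smooth_on U (\<lambda>x. plot_pullback1 A U \<phi> \<alpha> x u)))"

definition path_2form ::
  "'m topology \<Rightarrow> ('m, 'e::euclidean_space) chart set \<Rightarrow> 'u::euclidean_space itself \<Rightarrow>
   ('m, 'e) path_form2 \<Rightarrow> bool" where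
  "path_2form X A TU \<beta> \<longleftrightarrow>
     (\<forall>\<gamma>\<in>path_space X A. alt_bilinear_on path_tvec_comb (path_tangent A \<gamma>) (\<beta> \<gamma>)) \<and>
     (\<forall>(U :: 'u set) \<phi>. path_plot X A U \<phi> \<longrightarrow>
        (\<forall>u v. smooth_on U (\<lambda>x. plot_pullback2 A U \<phi> \<beta> x u v)))"

text \<open>The exterior derivative of a 1-form on a convex region: \<open>da(u, v) = u a(v) - v a(u)\<close> for constant
  vector fields, without a factor 1/2.\<close>

definition ext_deriv1 ::
  "'u::euclidean_space set \<Rightarrow> ('u \<Rightarrow> 'u \<Rightarrow> real) \<Rightarrow> 'u \<Rightarrow> 'u \<Rightarrow> 'u \<Rightarrow> real" where
  "ext_deriv1 U a x u v =
     frechet_derivative (\<lambda>y. a y v) (at x within U) u - frechet_derivative (\<lambda>y. a y u) (at x within U) v"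

text \<open>Chen's exterior derivative on the path space: \<open>\<beta> = d \<alpha>\<close> if the pullback of \<open>\<beta>\<close> along every plot is
  the exterior derivative of the pullback of \<open>\<alpha>\<close>.\<close>

definition is_path_ext_deriv ::
  "'m topology \<Rightarrow> ('m, 'e::euclidean_space) chart set \<Rightarrow> 'u::euclidean_space itself \<Rightarrow>
   ('m, 'e) path_form1 \<Rightarrow> ('m, 'e) path_form2 \<Rightarrow> bool" where
  "is_path_ext_deriv X A TU \<alpha> \<beta> \<longleftrightarrow>
     path_1form X A TU \<alpha> \<and> path_2form X A TU \<beta> \<and>
     (\<forall>(U :: 'u set) \<phi>. path_plot X A U \<phi> \<longrightarrow>
        (\<forall>x\<in>U. \<forall>u v. plot_pullback2 A U \<phi> \<beta> x u v = ext_deriv1 U (plot_pullback1 A U \<phi> \<alpha>) x u v))"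


section \<open>The forms induced by \<open>\<omega>\<close>\<close>

definition ev :: "real \<Rightarrow> (real \<Rightarrow> 'm) \<Rightarrow> 'm" where
  "ev t \<gamma> = \<gamma> t"

definition d_ev :: "real \<Rightarrow> ('m, 'e) path_tvec \<Rightarrow> ('m, 'e) tvec" where
  "d_ev t V = V t"

definition ev_pullback ::
  "real \<Rightarrow> ('m \<Rightarrow> ('m, 'e) tvec \<Rightarrow> ('m, 'e) tvec \<Rightarrow> real) \<Rightarrow> ('m, 'e) path_form2" where
  "ev_pullback t \<omega> \<gamma> V W = \<omega> (ev t \<gamma>) (d_ev t V) (d_ev t W)"

definition path_omega ::
  "('m \<Rightarrow> ('m, 'e) tvec \<Rightarrow> ('m, 'e) tvec \<Rightarrow> real) \<Rightarrow> ('m, 'e) path_form2" where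
  "path_omega \<omega> \<gamma> V W = integral {0..1} (\<lambda>t. \<omega> (\<gamma> t) (d_ev t V) (d_ev t W))"

definition path_lambda ::
  "('m, 'e::euclidean_space) chart set \<Rightarrow> ('m \<Rightarrow> ('m, 'e) tvec \<Rightarrow> ('m, 'e) tvec \<Rightarrow> real) \<Rightarrow>
   ('m, 'e) path_form1" where
  "path_lambda A \<omega> \<gamma> V =
     integral {0..1} (\<lambda>t. integral {0..t} (\<lambda>\<tau>. \<omega> (\<gamma> \<tau>) (velocity A \<gamma> \<tau>) (d_ev \<tau> V)))"

end

theory Submission
  imports Defs
begin

text \<open>
  A plot \<open>\<phi>\<close> of the path space is a smooth map \<open>g (x, t) = \<phi> x t\<close> on \<open>U \<times> {0..1}\<close>, and differential
  forms on the path space are known through their pullbacks along plots.  For directions \<open>a\<close>, \<open>b\<close> in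
  \<open>U \<times> \<real>\<close> write \<open>G(a, b) = (g\<^sup>*\<omega>)(a, b)\<close>, a smooth function of \<open>(x, t)\<close>, and let \<open>e = (0, 1)\<close> be the
  time direction; directions \<open>u\<close>, \<open>v\<close> of \<open>U\<close> are identified with \<open>(u, 0)\<close>, \<open>(v, 0)\<close>.

  The form induced by \<open>\<omega>\<close> pulls back to \<open>\<integral>\<^sub>0\<^sup>1 G(u, v) dt\<close>, the evaluation form to \<open>G(u, v)\<close> at
  \<open>t = 0\<close>, and \<open>\<lambda>\<close> to \<open>\<integral>\<^sub>0\<^sup>1 \<integral>\<^sub>0\<^sup>t G(e, u) d\<tau> dt = \<integral>\<^sub>0\<^sup>1 (1 - t) G(e, u) dt\<close>.  Since \<open>\<omega>\<close> is closed,
  so is \<open>g\<^sup>*\<omega>\<close>; evaluated on the constant fields \<open>e\<close>, \<open>u\<close>, \<open>v\<close> this says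
  \<open>\<partial>\<^sub>u G(e, v) - \<partial>\<^sub>v G(e, u) = \<partial>\<^sub>t G(u, v)\<close>.  Differentiating under the integral sign and integrating
  by parts,
  \<open>(d\<lambda>)(u, v) = \<integral>\<^sub>0\<^sup>1 (1 - t) \<partial>\<^sub>t G(u, v) dt\<close> equals \<open>\<integral>\<^sub>0\<^sup>1 G(u, v) dt\<close> minus the value of
  \<open>G(u, v)\<close> at \<open>t = 0\<close>, which is the pullback of the difference of the two given 2-forms.  This
  difference is a form on the path space by construction, so it is the exterior derivative of \<open>\<lambda>\<close>.

  The work lies in the regularity.  The parameter domains are convex but need not be open, and time runs
  through a closed interval, so all derivatives are taken within sets that may have boundary points.
  \<open>region_frechet_derivative\<close> shows that they are unique there; \<open>Ck_on_compose\<close> and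
  \<open>Ck_on_integral_parameter\<close> give the calculus of iterated derivatives; \<open>second_derivative_symmetric\<close>
  extends the symmetry of second derivatives to boundary points, which is what
  \<open>pullback_of_closed_2form\<close> needs.  \<open>smooth_two_form_along\<close> supplies the smoothness of \<open>G\<close>, and
  \<open>path_lambda_ext_deriv\<close> carries out the computation above.
\<close>

section \<open>Derivatives within convex regions\<close>

text \<open>
  This class of sets contains the domains of plots and of paths, their products and all open sets, and
  it is closed under intersection with open sets, which makes restriction to charts possible.  At every
  point such a set contains short segments in all directions of some open cone; hence derivatives
  within it are unique.
\<close>

definition region :: "'a::euclidean_space set \<Rightarrow> bool" where
  "region S \<longleftrightarrow> (\<exists>C T. convex C \<and> interior C \<noteq> {} \<and> open T \<and> S = C \<inter> T)"

lemma region_convex: "convex C \<Longrightarrow> interior C \<noteq> {} \<Longrightarrow> region C"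
  unfolding region_def by (intro exI[of _ C] exI[of _ UNIV]) auto

lemma region_open: "open T \<Longrightarrow> region T"
  unfolding region_def by (intro exI[of _ UNIV] exI[of _ T]) auto

lemma region_Int_open:
  assumes "region S" "open T"
  shows "region (S \<inter> T)"
proof -
  obtain C T' where "convex C" "interior C \<noteq> {}" "open T'" "S = C \<inter> T'"
    using assms(1) unfolding region_def by blast
  then show ?thesis
    unfolding region_def using assms(2) by (intro exI[of _ C] exI[of _ "T' \<inter> T"]) auto
qed

text \<open>A convex set with an interior point lies in the closure of its interior, and intersecting with an open
  set does not spoil this.\<close>

lemma region_subset_closure_interior:
  assumes "region S"
  shows "S \<subseteq> closure (interior S)"
proof -
  obtain C T where C: "convex C" "interior C \<noteq> {}" "open T" "S = C \<inter> T"
    using assms unfolding region_def by blast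
  have "S \<subseteq> T \<inter> closure (interior C)"
    using C convex_closure_interior[of C] closure_subset[of C] by auto
  also have "\<dots> \<subseteq> closure (T \<inter> interior C)"
    using open_Int_closure_subset[OF C(3)] .
  also have "T \<inter> interior C = interior S"
    using C by (auto simp: interior_open)
  finally show ?thesis .
qed

text \<open>If the ball around \<open>y\<close> lies in the convex set, then so do the segments from \<open>x\<close> to the points of the
  ball; the open set only limits how far these segments may be followed.\<close>

lemma region_inner_ball:
  assumes "region S" "x \<in> S"
  obtains d r e where "r > 0" "e > 0" "\<And>v s. v \<in> ball d r \<Longrightarrow> 0 \<le> s \<Longrightarrow> s < e \<Longrightarrow> x + s *\<^sub>R v \<in> S"
proof -
  obtain C T where C: "convex C" "interior C \<noteq> {}" "open T" "S = C \<inter> T"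
    using assms unfolding region_def by blast
  obtain y r where r: "r > 0" "ball y r \<subseteq> C"
    using C(2) by (auto simp: mem_interior)
  obtain q where q: "q > 0" "ball x q \<subseteq> T"
    using C(3,4) assms(2) open_contains_ball by blast
  \<comment> \<open>\<open>K\<close> bounds the norms of all directions in the ball, so that moving by less than \<open>q / K\<close> stays in the open set.\<close>
  define K where "K = norm (y - x) + r + 1"
  have K: "K > 0" using r norm_ge_zero[of "y - x"] by (simp add: K_def add_nonneg_pos)
  show ?thesis
  proof (rule that[of r "min 1 (q / K)" "y - x"])
    fix v s assume v: "v \<in> ball (y - x) r" and s: "0 \<le> s" "s < min 1 (q / K)"
    have "x + v \<in> C" using v r by (auto simp: dist_norm algebra_simps)
    then have "(1 - s) *\<^sub>R x + s *\<^sub>R (x + v) \<in> C"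
      using C(1,4) s assms(2) by (intro convexD) auto
    then have 1: "x + s *\<^sub>R v \<in> C" by (simp add: algebra_simps)
    have "norm v \<le> norm (y - x) + norm (y - x - v)"
      using norm_triangle_ineq4[of "y - x" "y - x - v"] by simp
    also have "\<dots> \<le> K" using v by (simp add: K_def dist_norm)
    finally have "s * norm v \<le> s * K" using s by (intro mult_left_mono) auto
    also have "\<dots> < q" using s K by (simp add: field_simps)
    finally have "x + s *\<^sub>R v \<in> T" using q s by (auto simp: dist_norm)
    with 1 show "x + s *\<^sub>R v \<in> S" using C by auto
  qed (use r q K in auto)
qed

text \<open>The derivative in a direction \<open>v\<close> is determined by the values along a segment in that direction.  So
  \<open>L\<close> vanishes on a ball, and a linear map that vanishes on a nonempty open set is zero.\<close>

lemma region_has_derivative_zero: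
  fixes L :: "'a::euclidean_space \<Rightarrow> 'b::real_normed_vector"
  assumes S: "region S" "x \<in> S" and L: "((\<lambda>_. 0) has_derivative L) (at x within S)"
  shows "L w = 0"
proof -
  obtain d r e where r: "r > 0" "e > 0"
    and in_S: "\<And>v s. v \<in> ball d r \<Longrightarrow> 0 \<le> s \<Longrightarrow> s < e \<Longrightarrow> x + s *\<^sub>R v \<in> S"
    using region_inner_ball[OF S] by metis
  interpret L: bounded_linear L using L by (rule has_derivative_bounded_linear)
  have zero: "L v = 0" if v: "v \<in> ball d r" for v
  proof -
    have line: "((\<lambda>s. x + s *\<^sub>R v) has_derivative (\<lambda>s. s *\<^sub>R v)) (at 0 within {0..e/2})"
      by (auto intro!: derivative_eq_intros)
    have "((\<lambda>_. 0) has_derivative L) (at x within ((\<lambda>s. x + s *\<^sub>R v) ` {0..e/2}))"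
      using in_S[OF v] r by (intro has_derivative_subset[OF L]) auto
    then have "((\<lambda>_. 0) has_derivative (\<lambda>s. L (s *\<^sub>R v))) (at 0 within {0..e/2})"
      using has_derivative_in_compose[OF line, of "\<lambda>_. 0" L] by simp
    then have "((\<lambda>_. 0) has_vector_derivative L v) (at 0 within {0..e/2})"
      by (simp add: has_vector_derivative_def L.scaleR)
    then show "L v = 0"
      using vector_derivative_unique_within_closed_interval[of 0 "e/2" 0 "\<lambda>_. 0" "L v" 0] r by auto
  qed
  show ?thesis
  proof (cases "w = 0")
    case False
    define k where "k = r / (2 * norm w)"
    have k: "k > 0" using r False by (simp add: k_def)
    have "d + k *\<^sub>R w \<in> ball d r" "d \<in> ball d r"
      using r False by (auto simp: k_def dist_norm)
    then have "L (d + k *\<^sub>R w) = 0" "L d = 0" by (auto intro: zero)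
    then show ?thesis using k by (simp add: L.add L.scaleR)
  qed (simp add: L.zero)
qed

lemma region_frechet_derivative:
  fixes f :: "'a::euclidean_space \<Rightarrow> 'b::real_normed_vector"
  assumes "region S" "x \<in> S" and f: "(f has_derivative f') (at x within S)"
  shows "frechet_derivative f (at x within S) = f'"
proof
  fix w
  have "f differentiable (at x within S)" using f by (rule differentiableI)
  then have "(f has_derivative frechet_derivative f (at x within S)) (at x within S)"
    by (simp add: frechet_derivative_works)
  from has_derivative_diff[OF this f]
  have "((\<lambda>_. 0) has_derivative (\<lambda>w. frechet_derivative f (at x within S) w - f' w)) (at x within S)"
    by simp
  from region_has_derivative_zero[OF assms(1,2) this]
  show "frechet_derivative f (at x within S) w = f' w" by simp
qed

text \<open>Here \<open>S\<close> is arbitrary: both functions have the same derivatives within \<open>S\<close>, so the choice operator in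
  \<^const>\<open>frechet_derivative\<close> selects the same one, even where none exists.\<close>

lemma frechet_derivative_cong:
  assumes "x \<in> S" "\<And>y. y \<in> S \<Longrightarrow> f y = g y"
  shows "frechet_derivative f (at x within S) = frechet_derivative g (at x within S)"
proof -
  have "(f has_derivative f') (at x within S) \<longleftrightarrow> (g has_derivative f') (at x within S)" for f'
    using assms by (metis has_derivative_transform)
  then show ?thesis unfolding frechet_derivative_def by simp
qed

lemma at_within_Int_open: "open T \<Longrightarrow> x \<in> T \<Longrightarrow> at x within (S \<inter> T) = at x within S"
  by (rule at_within_nhd[of x T]) auto

section \<open>Functions of class \<open>C\<^sup>k\<close> on regions\<close>

lemma Ck_on_cong:
  assumes "\<And>x. x \<in> S \<Longrightarrow> f x = g x"
  shows "Ck_on k S f \<longleftrightarrow> Ck_on k S g"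
  using assms
proof (induction k arbitrary: f g)
  case 0
  then show ?case by (simp cong: continuous_on_cong)
next
  case (Suc k)
  have "f differentiable (at x within S) \<longleftrightarrow> g differentiable (at x within S)" if "x \<in> S" for x
    using Suc.prems that unfolding differentiable_def by (metis has_derivative_transform)
  moreover have "Ck_on k S (\<lambda>x. frechet_derivative f (at x within S) v) \<longleftrightarrow>
        Ck_on k S (\<lambda>x. frechet_derivative g (at x within S) v)" for v
  proof (rule Suc.IH)
    show "frechet_derivative f (at x within S) v = frechet_derivative g (at x within S) v"
      if "x \<in> S" for x
      using frechet_derivative_cong[OF that Suc.prems] by simp
  qed
  ultimately show ?case by simp
qed

lemma Ck_on_transform: "Ck_on k S f \<Longrightarrow> (\<And>x. x \<in> S \<Longrightarrow> g x = f x) \<Longrightarrow> Ck_on k S g"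
  using Ck_on_cong[of S f g k] by simp

lemma Ck_on_Int_open:
  assumes "Ck_on k S f" "open T"
  shows "Ck_on k (S \<inter> T) f"
  using assms(1)
proof (induction k arbitrary: f)
  case 0
  then show ?case by (auto intro: continuous_on_subset)
next
  case (Suc k)
  have "Ck_on k (S \<inter> T) (\<lambda>x. frechet_derivative f (at x within (S \<inter> T)) v) \<longleftrightarrow>
        Ck_on k (S \<inter> T) (\<lambda>x. frechet_derivative f (at x within S) v)" for v
    using assms(2) by (intro Ck_on_cong) (auto simp: at_within_Int_open)
  with Suc show ?case using assms(2) by (auto simp: at_within_Int_open)
qed

lemma Ck_on_local:
  assumes "\<And>x. x \<in> S \<Longrightarrow> \<exists>T. open T \<and> x \<in> T \<and> Ck_on k (S \<inter> T) f"
  shows "Ck_on k S f"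
  using assms
proof (induction k arbitrary: f)
  case 0
  show ?case unfolding Ck_on.simps continuous_on_eq_continuous_within
  proof
    fix x assume "x \<in> S"
    from 0[OF this] obtain T where T: "open T" "x \<in> T" "Ck_on 0 (S \<inter> T) f" by blast
    then have "continuous (at x within (S \<inter> T)) f"
      using \<open>x \<in> S\<close> by (simp add: continuous_on_eq_continuous_within)
    then show "continuous (at x within S) f"
      using T(1,2) by (simp add: at_within_Int_open)
  qed
next
  case (Suc k)
  have "f differentiable (at x within S)" if "x \<in> S" for x
  proof -
    obtain T where T: "open T" "x \<in> T" "Ck_on (Suc k) (S \<inter> T) f" using Suc.prems \<open>x \<in> S\<close> by blast
    then have "f differentiable (at x within (S \<inter> T))" using that by simp
    then show ?thesis by (simp only: at_within_Int_open[OF T(1,2)])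
  qed
  moreover have "Ck_on k S (\<lambda>x. frechet_derivative f (at x within S) v)" for v
  proof (rule Suc.IH)
    fix x assume "x \<in> S"
    then obtain T where T: "open T" "x \<in> T" "Ck_on (Suc k) (S \<inter> T) f" using Suc.prems by blast
    then have "Ck_on k (S \<inter> T) (\<lambda>x. frechet_derivative f (at x within (S \<inter> T)) v)" by simp
    moreover have "Ck_on k (S \<inter> T) (\<lambda>x. frechet_derivative f (at x within (S \<inter> T)) v) \<longleftrightarrow>
        Ck_on k (S \<inter> T) (\<lambda>x. frechet_derivative f (at x within S) v)"
      using T(1) by (intro Ck_on_cong) (auto simp: at_within_Int_open)
    ultimately show "\<exists>T. open T \<and> x \<in> T \<and> Ck_on k (S \<inter> T) (\<lambda>x. frechet_derivative f (at x within S) v)"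
      using T(1,2) by blast
  qed
  ultimately show ?case by simp
qed

lemma Ck_on_Suc_imp: "Ck_on (Suc k) S f \<Longrightarrow> Ck_on k S f"
proof (induction k arbitrary: f)
  case 0
  then show ?case
    by (auto simp: continuous_on_eq_continuous_within intro: differentiable_imp_continuous_within)
next
  case (Suc k)
  then show ?case unfolding Ck_on.simps(2)[of "Suc k"] Ck_on.simps(2)[of k S f] by blast
qed

lemma Ck_on_mono: "Ck_on k S f \<Longrightarrow> j \<le> k \<Longrightarrow> Ck_on j S f"
proof (induction k)
  case (Suc k)
  then show ?case using Ck_on_Suc_imp[of k S f] by (cases "j = Suc k") simp_all
qed simp

lemma Ck_on_imp_continuous_on: "Ck_on k S f \<Longrightarrow> continuous_on S f"
  by (induction k) (auto dest: Ck_on_Suc_imp simp del: Ck_on.simps(2))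

lemma Ck_on_has_derivative:
  "Ck_on (Suc k) S f \<Longrightarrow> x \<in> S \<Longrightarrow>
    (f has_derivative frechet_derivative f (at x within S)) (at x within S)"
  by (simp add: frechet_derivative_works)

lemma Ck_on_frechet_derivative:
  "Ck_on (Suc k) S f \<Longrightarrow> Ck_on k S (\<lambda>x. frechet_derivative f (at x within S) v)"
  by simp

lemma Ck_on_SucI:
  assumes "region S"
    and D: "\<And>x. x \<in> S \<Longrightarrow> (f has_derivative f' x) (at x within S)"
    and "\<And>v. Ck_on k S (\<lambda>x. f' x v)"
  shows "Ck_on (Suc k) S f"
proof -
  have "Ck_on k S (\<lambda>x. frechet_derivative f (at x within S) v) \<longleftrightarrow> Ck_on k S (\<lambda>x. f' x v)" for v
    using region_frechet_derivative[OF assms(1) _ D] by (intro Ck_on_cong) simp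
  then show ?thesis using assms(3) D by (auto intro: differentiableI)
qed

lemma Ck_on_const: "region S \<Longrightarrow> Ck_on k S (\<lambda>_. c)"
proof (induction k arbitrary: c)
  case (Suc k)
  then show ?case by (intro Ck_on_SucI[where f' = "\<lambda>_ _. 0"]) auto
qed simp

lemma Ck_on_bounded_linear_compose:
  assumes S: "region S" and L: "bounded_linear L"
  shows "Ck_on k S f \<Longrightarrow> Ck_on k S (\<lambda>x. L (f x))"
proof (induction k arbitrary: f)
  case 0
  then show ?case by (simp add: bounded_linear.continuous_on[OF L])
next
  case (Suc k)
  show ?case
  proof (rule Ck_on_SucI[OF S])
    show "((\<lambda>x. L (f x)) has_derivative (\<lambda>v. L (frechet_derivative f (at x within S) v))) (at x within S)"
      if "x \<in> S" for x
      by (rule bounded_linear.has_derivative[OF L Ck_on_has_derivative[OF Suc.prems that]])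
  qed (use Suc in auto)
qed

lemma Ck_on_id:
  assumes "region S"
  shows "Ck_on k S (\<lambda>x. x)"
proof (cases k)
  case (Suc n)
  show ?thesis unfolding Suc
    by (rule Ck_on_SucI[OF assms, where f' = "\<lambda>_ v. v"]) (simp_all add: Ck_on_const[OF assms])
qed (simp add: continuous_on_id)

lemma Ck_on_bounded_linear: "region S \<Longrightarrow> bounded_linear L \<Longrightarrow> Ck_on k S L"
  using Ck_on_bounded_linear_compose[OF _ _ Ck_on_id] by blast

lemma Ck_on_add:
  assumes S: "region S"
  shows "Ck_on k S f \<Longrightarrow> Ck_on k S g \<Longrightarrow> Ck_on k S (\<lambda>x. f x + g x)"
proof (induction k arbitrary: f g)
  case 0
  then show ?case by (simp add: continuous_on_add)
next
  case (Suc k)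
  show ?case
    by (rule Ck_on_SucI[OF S has_derivative_add[OF Ck_on_has_derivative[OF Suc.prems(1)]
          Ck_on_has_derivative[OF Suc.prems(2)]]])
      (use Suc in auto)
qed

lemma Ck_on_diff:
  assumes "region S" "Ck_on k S f" "Ck_on k S g"
  shows "Ck_on k S (\<lambda>x. f x - g x)"
  using Ck_on_add[OF assms(1,2) Ck_on_bounded_linear_compose[OF assms(1) _ assms(3), of uminus]]
  by (simp add: bounded_linear_minus[OF bounded_linear_ident])

lemma Ck_on_sum:
  assumes "region S" "\<And>i. i \<in> I \<Longrightarrow> Ck_on k S (f i)"
  shows "Ck_on k S (\<lambda>x. \<Sum>i\<in>I. f i x)"
proof (cases "finite I")
  case True
  then show ?thesis using assms(2)
    by (induction I rule: finite_induct) (auto intro: Ck_on_const Ck_on_add assms(1))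
qed (simp add: Ck_on_const assms(1))

lemma Ck_on_scaleR:
  fixes f :: "'a::euclidean_space \<Rightarrow> real"
  assumes S: "region S"
  shows "Ck_on k S f \<Longrightarrow> Ck_on k S g \<Longrightarrow> Ck_on k S (\<lambda>x. f x *\<^sub>R g x)"
proof (induction k arbitrary: f g)
  case 0
  then show ?case by (simp add: continuous_on_scaleR)
next
  case (Suc k)
  show ?case
  proof (rule Ck_on_SucI[OF S has_derivative_scaleR[OF Ck_on_has_derivative[OF Suc.prems(1)]
          Ck_on_has_derivative[OF Suc.prems(2)]]])
    show "Ck_on k S (\<lambda>x. f x *\<^sub>R frechet_derivative g (at x within S) v +
            frechet_derivative f (at x within S) v *\<^sub>R g x)" for v
      by (intro Ck_on_add[OF S] Suc.IH Ck_on_frechet_derivative Suc.prems Ck_on_Suc_imp)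
  qed
qed

lemma Ck_on_mult:
  fixes f g :: "'a::euclidean_space \<Rightarrow> real"
  shows "region S \<Longrightarrow> Ck_on k S f \<Longrightarrow> Ck_on k S g \<Longrightarrow> Ck_on k S (\<lambda>x. f x * g x)"
  using Ck_on_scaleR[of S k f g] by simp

lemma linear_euclidean_sum:
  fixes L :: "'a::euclidean_space \<Rightarrow> 'b::real_vector"
  assumes "linear L"
  shows "L v = (\<Sum>b\<in>Basis. (v \<bullet> b) *\<^sub>R L b)"
proof -
  have "L v = L (\<Sum>b\<in>Basis. (v \<bullet> b) *\<^sub>R b)" by (simp add: euclidean_representation)
  also have "\<dots> = (\<Sum>b\<in>Basis. (v \<bullet> b) *\<^sub>R L b)"
    by (simp add: linear_sum[OF assms] linear_scale[OF assms])
  finally show ?thesis .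
qed

text \<open>Expanding \<open>D(f \<circ> g)(v) = \<Sum>\<^sub>b (Dg(v) \<bullet> b) \<cdot> (\<partial>\<^sub>b f \<circ> g)\<close> in a basis reduces the derivative of a
  composite to products of functions of class \<open>C\<^sup>k\<close>, with compositions of the same form.\<close>

lemma Ck_on_compose:
  fixes f :: "'a::euclidean_space \<Rightarrow> 'b::real_normed_vector" and g :: "'c::euclidean_space \<Rightarrow> 'a"
  assumes S: "region S" and T: "region T" and sub: "g ` S \<subseteq> T"
  shows "Ck_on k T f \<Longrightarrow> Ck_on k S g \<Longrightarrow> Ck_on k S (\<lambda>x. f (g x))"
proof (induction k arbitrary: f)
  case 0
  then show ?case using sub by (auto intro: continuous_on_compose2)
next
  case (Suc k)
  show ?case
  proof (rule Ck_on_SucI[OF S])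
    fix x assume x: "x \<in> S"
    let ?F = "frechet_derivative f (at (g x) within T)" and ?G = "frechet_derivative g (at x within S)"
    have F: "(f has_derivative ?F) (at (g x) within T)"
      using Suc.prems(1) sub x by (intro Ck_on_has_derivative) auto
    have "((\<lambda>x. f (g x)) has_derivative (\<lambda>v. ?F (?G v))) (at x within S)"
      using sub by (intro has_derivative_in_compose[OF Ck_on_has_derivative[OF Suc.prems(2) x]]
          has_derivative_subset[OF F])
    moreover have "?F (?G v) = (\<Sum>b\<in>Basis. (?G v \<bullet> b) *\<^sub>R ?F b)" for v
      using F by (intro linear_euclidean_sum has_derivative_linear)
    ultimately show "((\<lambda>x. f (g x)) has_derivative
        (\<lambda>v. \<Sum>b\<in>Basis. (frechet_derivative g (at x within S) v \<bullet> b) *\<^sub>R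
              frechet_derivative f (at (g x) within T) b)) (at x within S)"
      by simp
  next
    fix v
    show "Ck_on k S (\<lambda>x. \<Sum>b\<in>Basis. (frechet_derivative g (at x within S) v \<bullet> b) *\<^sub>R
              frechet_derivative f (at (g x) within T) b)"
    proof (intro Ck_on_sum[OF S] Ck_on_scaleR[OF S])
      show "Ck_on k S (\<lambda>x. frechet_derivative g (at x within S) v \<bullet> b)" for b
        by (rule Ck_on_bounded_linear_compose[OF S bounded_linear_inner_left
              Ck_on_frechet_derivative[OF Suc.prems(2)]])
      show "Ck_on k S (\<lambda>x. frechet_derivative f (at (g x) within T) b)" for b
        by (rule Suc.IH[OF Ck_on_frechet_derivative[OF Suc.prems(1)] Ck_on_Suc_imp[OF Suc.prems(2)]])
    qed
  qed
qed

section \<open>Integrals depending on a parameter\<close>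

lemma region_Times_interval:
  fixes U :: "'u::euclidean_space set"
  assumes "convex U" "interior U \<noteq> {}"
  shows "region (U \<times> {0..1::real})"
  using assms by (intro region_convex) (auto simp: convex_Times interior_Times)

lemma has_derivative_slice_fst:
  assumes "(f has_derivative f') (at (x, t) within U \<times> T)" "t \<in> T"
  shows "((\<lambda>y. f (y, t)) has_derivative (\<lambda>u. f' (u, 0))) (at x within U)"
proof (rule has_derivative_in_compose[where g = f])
  show "((\<lambda>y. (y, t)) has_derivative (\<lambda>u. (u, 0))) (at x within U)"
    by (auto intro!: derivative_eq_intros)
  show "(f has_derivative f') (at (x, t) within (\<lambda>y. (y, t)) ` U)"
    using assms by (intro has_derivative_subset[OF assms(1)]) auto
qed

lemma has_derivative_slice_snd:
  assumes "(f has_derivative f') (at (x, t) within U \<times> T)" "x \<in> U"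
  shows "((\<lambda>s. f (x, s)) has_derivative (\<lambda>u. f' (0, u))) (at t within T)"
proof (rule has_derivative_in_compose[where g = f])
  show "((\<lambda>s. (x, s)) has_derivative (\<lambda>u. (0, u))) (at t within T)"
    by (auto intro!: derivative_eq_intros)
  show "(f has_derivative f') (at (x, t) within (\<lambda>s. (x, s)) ` T)"
    using assms by (intro has_derivative_subset[OF assms(1)]) auto
qed

text \<open>The Leibniz rule for derivatives within a convex set.  It asks for a derivative that depends continuously on
  \<open>(x, t)\<close> as an element of the space of linear maps; in finite dimension this can be checked on basis
  vectors.\<close>

lemma has_derivative_integral_parameter:
  fixes f :: "'u::euclidean_space \<times> real \<Rightarrow> 'b::banach"
  assumes U: "convex U" and f: "Ck_on (Suc 0) (U \<times> {0..1}) f" and x: "x \<in> U"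
  shows "((\<lambda>x. integral {0..1} (\<lambda>t. f (x, t))) has_derivative
    (\<lambda>u. integral {0..1} (\<lambda>t. frechet_derivative f (at (x, t) within U \<times> {0..1}) (u, 0)))) (at x within U)"
proof -
  define L where "L y t = (\<lambda>u. frechet_derivative f (at (y, t) within U \<times> {0..1}) (u, 0))" for y t
  have slice: "((\<lambda>y. f (y, t)) has_derivative L y t) (at y within U)" if "y \<in> U" "t \<in> {0..1}" for y t
    unfolding L_def using that by (intro has_derivative_slice_fst[OF Ck_on_has_derivative[OF f]]) auto
  define F where "F y t = Blinfun (L y t)" for y t
  have F: "blinfun_apply (F y t) = L y t" if "y \<in> U" "t \<in> {0..1}" for y t
    unfolding F_def by (rule bounded_linear_Blinfun_apply[OF has_derivative_bounded_linear[OF slice[OF that]]])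
  have contF: "continuous_on (U \<times> {0..1}) (\<lambda>(y, t). F y t)"
    unfolding continuous_on_def
  proof
    fix z assume z: "z \<in> U \<times> {0..1::real}"
    show "((\<lambda>(y, t). F y t) \<longlongrightarrow> (case z of (y, t) \<Rightarrow> F y t)) (at z within U \<times> {0..1})"
    proof (rule tendsto_componentwise1)
      fix j :: 'u
      have "continuous_on (U \<times> {0..1}) (\<lambda>z. frechet_derivative f (at z within U \<times> {0..1}) (j, 0))"
        using Ck_on_frechet_derivative[OF f] by simp
      then have "((\<lambda>z. frechet_derivative f (at z within U \<times> {0..1}) (j, 0)) \<longlongrightarrow>
          frechet_derivative f (at z within U \<times> {0..1}) (j, 0)) (at z within U \<times> {0..1})"
        using z unfolding continuous_on_def by blast
      moreover have "\<forall>\<^sub>F w in at z within U \<times> {0..1}. frechet_derivative f (at w within U \<times> {0..1}) (j, 0)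
          = blinfun_apply (case w of (y, t) \<Rightarrow> F y t) j"
        unfolding eventually_at_filter by (rule always_eventually) (auto simp: F L_def)
      ultimately have "((\<lambda>w. blinfun_apply (case w of (y, t) \<Rightarrow> F y t) j) \<longlongrightarrow>
          frechet_derivative f (at z within U \<times> {0..1}) (j, 0)) (at z within U \<times> {0..1})"
        by (rule Lim_transform_eventually)
      then show "((\<lambda>w. blinfun_apply (case w of (y, t) \<Rightarrow> F y t) j) \<longlongrightarrow>
          blinfun_apply (case z of (y, t) \<Rightarrow> F y t) j) (at z within U \<times> {0..1})"
        using z by (auto simp: F L_def)
    qed
  qed
  have "((\<lambda>x. integral (cbox 0 1) (\<lambda>t. f (x, t))) has_derivative integral (cbox 0 1) (F x)) (at x within U)"
  proof (rule leibniz_rule[OF _ _ _ x U])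
    show "((\<lambda>x. f (x, t)) has_derivative blinfun_apply (F y t)) (at y within U)"
      if "y \<in> U" "t \<in> cbox 0 1" for y t
      using slice F that by (simp add: box_real)
    show "(\<lambda>t. f (y, t)) integrable_on cbox 0 1" if "y \<in> U" for y
      using that unfolding cbox_interval
      by (intro integrable_continuous_interval continuous_on_compose2[OF Ck_on_imp_continuous_on[OF f]])
        (auto intro!: continuous_intros)
    show "continuous_on (U \<times> cbox 0 1) (\<lambda>(y, t). F y t)"
      using contF by (simp add: box_real)
  qed
  moreover have "blinfun_apply (integral (cbox 0 1) (F x)) u = integral {0..1} (\<lambda>t. L x t u)" for u
  proof -
    have "F x integrable_on {0..1}"
      using x by (intro integrable_continuous_interval continuous_on_compose2[OF contF, of _ "\<lambda>t. (x, t)", simplified])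
        (auto intro!: continuous_intros)
    from integral_linear[OF this, of "\<lambda>A. blinfun_apply A u"]
    have "blinfun_apply (integral {0..1} (F x)) u = integral {0..1} (\<lambda>t. blinfun_apply (F x t) u)"
      by (simp add: o_def blinfun.bounded_linear_left)
    also have "\<dots> = integral {0..1} (\<lambda>t. L x t u)"
      using F x by (intro integral_cong) simp
    finally show ?thesis by (simp add: box_real)
  qed
  then have "blinfun_apply (integral (cbox 0 1) (F x)) = (\<lambda>u. integral {0..1} (\<lambda>t. L x t u))" by blast
  ultimately show ?thesis by (simp add: box_real L_def)
qed

lemma Ck_on_integral_parameter:
  fixes f :: "'u::euclidean_space \<times> real \<Rightarrow> 'b::banach"
  assumes U: "convex U" "interior U \<noteq> {}"
  shows "Ck_on k (U \<times> {0..1}) f \<Longrightarrow> Ck_on k U (\<lambda>x. integral {0..1} (\<lambda>t. f (x, t)))"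
proof (induction k arbitrary: f)
  case 0
  then show ?case
    using integral_continuous_on_param[of U 0 1 "\<lambda>x t. f (x, t)"] by (simp add: box_real split_def)
next
  case (Suc k)
  have "Ck_on (Suc 0) (U \<times> {0..1}) f"
    by (rule Ck_on_mono[OF Suc.prems]) simp
  then show ?case
    by (intro Ck_on_SucI[OF region_convex[OF U] has_derivative_integral_parameter[OF U(1)]])
      (use Suc.IH[OF Ck_on_frechet_derivative[OF Suc.prems]] in auto)
qed

lemma integral_derivative_segment:
  fixes f :: "'a::euclidean_space \<Rightarrow> 'b::banach"
  assumes f: "Ck_on (Suc 0) S f" and seg: "\<And>t. t \<in> {0..1} \<Longrightarrow> p + t *\<^sub>R v \<in> S"
  shows "integral {0..1} (\<lambda>t. frechet_derivative f (at (p + t *\<^sub>R v) within S) v) = f (p + v) - f p"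
proof -
  let ?D = "\<lambda>t. frechet_derivative f (at (p + t *\<^sub>R v) within S)"
  have "((\<lambda>t. f (p + t *\<^sub>R v)) has_vector_derivative ?D t v) (at t within {0..1})" if t: "t \<in> {0..1}" for t
  proof -
    have D: "(f has_derivative ?D t) (at (p + t *\<^sub>R v) within S)"
      by (rule Ck_on_has_derivative[OF f seg[OF t]])
    have "((\<lambda>t. f (p + t *\<^sub>R v)) has_derivative (\<lambda>s. ?D t (s *\<^sub>R v))) (at t within {0..1})"
      by (rule has_derivative_in_compose[where g = f])
        (auto intro!: derivative_eq_intros has_derivative_subset[OF D] seg)
    then show ?thesis
      unfolding has_vector_derivative_def by (simp add: linear_scale[OF has_derivative_linear[OF D]])
  qed
  then have "((\<lambda>t. ?D t v) has_integral f (p + 1 *\<^sub>R v) - f (p + 0 *\<^sub>R v)) {0..1}"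
    by (intro fundamental_theorem_of_calculus) auto
  then show ?thesis by (simp add: integral_unique)
qed

section \<open>Symmetry of second derivatives\<close>

lemma norm_scaleR_unit_le: "t \<in> {0..1} \<Longrightarrow> norm (t *\<^sub>R x) \<le> norm x"
  by (auto intro: mult_left_le_one_le)

text \<open>For small \<open>w\<close> the increment \<open>f (x + w) - f x\<close> is the integral of \<open>D f (x + t w) w\<close> over \<open>t\<close>.
  Differentiating it at \<open>p\<close> in direction \<open>u\<close> under the integral gives the integral of
  \<open>D\<^sub>u D\<^sub>w f (p + t w)\<close>; but \<open>D\<^sub>u f (p + w) - D\<^sub>u f p\<close> is also the integral of \<open>D\<^sub>w D\<^sub>u f (p + t w)\<close>.
  So the commutator of the two derivatives has mean zero along every short segment starting at \<open>p\<close>, and,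
  being continuous, it vanishes at \<open>p\<close>.\<close>

lemma second_derivative_symmetric_open:
  fixes f :: "'a::euclidean_space \<Rightarrow> 'b::banach"
  assumes T: "open T" and f: "Ck_on (Suc (Suc 0)) T f" and p: "p \<in> T"
  shows "frechet_derivative (\<lambda>x. frechet_derivative f (at x within T) u) (at p within T) v =
         frechet_derivative (\<lambda>x. frechet_derivative f (at x within T) v) (at p within T) u"
proof -
  let ?D = "\<lambda>a x. frechet_derivative f (at x within T) a"
  let ?DD = "\<lambda>a b x. frechet_derivative (?D a) (at x within T) b"
  have C1: "Ck_on (Suc 0) T (?D a)" for a using f by (rule Ck_on_frechet_derivative)
  have fC1: "Ck_on (Suc 0) T f" using f by (rule Ck_on_Suc_imp)
  have contDD: "continuous_on T (?DD a b)" for a b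
    using Ck_on_frechet_derivative[OF C1] by simp
  have scale: "?D (r *\<^sub>R a) x = r *\<^sub>R ?D a x" if "x \<in> T" for r a x
    using linear_scale[OF has_derivative_linear[OF Ck_on_has_derivative[OF fC1 that]]] .
  obtain r where r: "r > 0" "ball p (2 * r) \<subseteq> T"
  proof -
    obtain e where "e > 0" "ball p e \<subseteq> T" using T p open_contains_ball by blast
    then show ?thesis by (intro that[of "e/2"]) auto
  qed
  have zero: "integral {0..1} (\<lambda>t. ?DD w u (p + t *\<^sub>R w)) = integral {0..1} (\<lambda>t. ?DD u w (p + t *\<^sub>R w))"
    if w: "norm w < r" for w
  proof -
    have in_T: "x + t *\<^sub>R w \<in> T" if "x \<in> ball p r" "t \<in> {0..1}" for x t
    proof -
      have "norm (t *\<^sub>R w) \<le> norm w" by (rule norm_scaleR_unit_le[OF that(2)])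
      moreover have "norm (p - (x + t *\<^sub>R w)) \<le> norm (p - x) + norm (t *\<^sub>R w)"
        using norm_triangle_ineq4[of "p - x" "t *\<^sub>R w"] by (simp add: algebra_simps)
      ultimately have "x + t *\<^sub>R w \<in> ball p (2 * r)" using that(1) w by (simp add: dist_norm)
      then show ?thesis using r(2) by blast
    qed
    let ?B = "ball p r" and ?g = "\<lambda>z. ?D w (fst z + snd z *\<^sub>R w)"
    have ne: "interior ?B \<noteq> {}" using r by (simp add: interior_open)
    have pB: "p \<in> ?B" using r by simp
    have rB: "region (?B \<times> {0..1::real})" by (rule region_Times_interval[OF convex_ball ne])
    have bl: "bounded_linear (\<lambda>z::'a \<times> real. fst z + snd z *\<^sub>R w)"
      by (intro bounded_linear_add bounded_linear_fst
          bounded_linear_compose[OF bounded_linear_scaleR_left bounded_linear_snd])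
    have g: "Ck_on (Suc 0) (?B \<times> {0..1}) ?g"
      by (rule Ck_on_compose[OF rB region_open[OF T] _ C1 Ck_on_bounded_linear[OF rB bl]])
        (use in_T in auto)
    have dg: "frechet_derivative ?g (at (p, t) within ?B \<times> {0..1}) (u, 0) = ?DD w u (p + t *\<^sub>R w)"
      if t: "t \<in> {0..1}" for t
    proof -
      have D: "(?D w has_derivative (\<lambda>b. ?DD w b (p + t *\<^sub>R w))) (at (p + t *\<^sub>R w) within T)"
        by (rule Ck_on_has_derivative[OF C1 in_T[OF pB t]])
      have "(?g has_derivative (\<lambda>h. ?DD w (fst h + snd h *\<^sub>R w) (p + t *\<^sub>R w))) (at (p, t) within ?B \<times> {0..1})"
        by (rule has_derivative_in_compose[where g = "?D w"])
          (use in_T in \<open>auto intro!: bounded_linear_imp_has_derivative[OF bl] has_derivative_subset[OF D]\<close>)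
      from region_frechet_derivative[OF rB _ this] show ?thesis using pB t by simp
    qed
    have int_g: "integral {0..1} (\<lambda>t. ?g (x, t)) = f (x + w) - f x" if "x \<in> ?B" for x
      using integral_derivative_segment[OF fC1, of x w] in_T[OF that] by simp
    have der_g: "((\<lambda>x. integral {0..1} (\<lambda>t. ?g (x, t))) has_derivative
        (\<lambda>h. integral {0..1} (\<lambda>t. frechet_derivative ?g (at (p, t) within ?B \<times> {0..1}) (h, 0)))) (at p within ?B)"
      by (rule has_derivative_integral_parameter[OF convex_ball g pB])
    have 1: "((\<lambda>x. f (x + w) - f x) has_derivative
        (\<lambda>h. integral {0..1} (\<lambda>t. frechet_derivative ?g (at (p, t) within ?B \<times> {0..1}) (h, 0)))) (at p within ?B)"
      by (rule has_derivative_transform[OF pB _ der_g]) (rule int_g[symmetric])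
    have D1: "(f has_derivative (\<lambda>b. ?D b (p + w))) (at (p + w) within T)"
      using in_T[OF pB, of 1] by (intro Ck_on_has_derivative[OF fC1]) auto
    have D0: "(f has_derivative (\<lambda>b. ?D b p)) (at p within ?B)"
      using in_T[of _ 0] by (intro has_derivative_subset[OF Ck_on_has_derivative[OF fC1 p]]) auto
    have "((\<lambda>x. f (x + w)) has_derivative (\<lambda>b. ?D b (p + w))) (at p within ?B)"
    proof (rule has_derivative_in_compose[where g = f])
      show "((\<lambda>x. x + w) has_derivative (\<lambda>b. b)) (at p within ?B)"
        by (auto intro!: derivative_eq_intros)
      show "(f has_derivative (\<lambda>b. ?D b (p + w))) (at (p + w) within (\<lambda>x. x + w) ` ?B)"
        by (rule has_derivative_subset[OF D1]) (use in_T[of _ 1] in auto)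
    qed
    from region_frechet_derivative[OF region_open[OF open_ball] pB has_derivative_diff[OF this D0]]
      region_frechet_derivative[OF region_open[OF open_ball] pB 1]
    have "(\<lambda>b. ?D b (p + w) - ?D b p) =
        (\<lambda>h. integral {0..1} (\<lambda>t. frechet_derivative ?g (at (p, t) within ?B \<times> {0..1}) (h, 0)))"
      by (rule trans[OF sym])
    then have "?D u (p + w) - ?D u p = integral {0..1} (\<lambda>t. frechet_derivative ?g (at (p, t) within ?B \<times> {0..1}) (u, 0))"
      by (rule fun_cong)
    also have "\<dots> = integral {0..1} (\<lambda>t. ?DD w u (p + t *\<^sub>R w))"
      by (intro integral_cong dg)
    finally show ?thesis
      using integral_derivative_segment[OF C1, of p w u] in_T[OF pB] by simp
  qed
  \<comment> \<open>Shrinking \<open>w = s v\<close> to \<open>p\<close>: the factor \<open>s\<close> cancels, and the mean \<open>E s\<close> of the commutator tends to its value at \<open>p\<close>.\<close>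
  define \<kappa> where "\<kappa> x = ?DD v u x - ?DD u v x" for x
  have contk: "continuous_on T \<kappa>" unfolding \<kappa>_def by (intro continuous_on_diff contDD)
  define e where "e = r / (norm v + 1)"
  have e: "e > 0" using r by (simp add: e_def add_nonneg_pos)
  have small: "norm (s *\<^sub>R v) < r" if "0 \<le> s" "s < e" for s
  proof -
    have "s * norm v \<le> s * (norm v + 1)" using that by (intro mult_left_mono) auto
    also have "\<dots> < r"
      using that(2) add_nonneg_pos[OF norm_ge_zero[of v] zero_less_one]
      unfolding e_def by (simp only: pos_less_divide_eq)
    finally show ?thesis using that by simp
  qed
  define E where "E s = integral {0..1} (\<lambda>t. \<kappa> (p + t *\<^sub>R s *\<^sub>R v))" for s
  have in_T: "p + t *\<^sub>R s *\<^sub>R v \<in> T" if "0 \<le> s" "s < e" "t \<in> {0..1}" for s t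
  proof -
    have "norm (t *\<^sub>R s *\<^sub>R v) \<le> norm (s *\<^sub>R v)" by (rule norm_scaleR_unit_le[OF that(3)])
    then have "p + t *\<^sub>R s *\<^sub>R v \<in> ball p (2 * r)" using small[OF that(1,2)] r(1) by (simp add: dist_norm)
    then show ?thesis using r by blast
  qed
  have DDs: "?DD (s *\<^sub>R v) u x = s *\<^sub>R ?DD v u x" "?DD u (s *\<^sub>R v) x = s *\<^sub>R ?DD u v x" if x: "x \<in> T" for s x
  proof -
    have "(?D (s *\<^sub>R v) has_derivative (\<lambda>b. s *\<^sub>R ?DD v b x)) (at x within T)"
      by (rule has_derivative_transform[OF x _ has_derivative_scaleR_right[OF Ck_on_has_derivative[OF C1 x]]])
        (simp add: scale)
    from region_frechet_derivative[OF region_open[OF T] x this]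
    show "?DD (s *\<^sub>R v) u x = s *\<^sub>R ?DD v u x" by simp
    show "?DD u (s *\<^sub>R v) x = s *\<^sub>R ?DD u v x"
      by (rule linear_scale[OF has_derivative_linear[OF Ck_on_has_derivative[OF C1 x]]])
  qed
  have int: "(\<lambda>t. ?DD a b (p + t *\<^sub>R s *\<^sub>R v)) integrable_on {0..1}" if "0 \<le> s" "s < e" for a b s
    using in_T[OF that]
    by (intro integrable_continuous_interval continuous_on_compose2[OF contDD]) (auto intro!: continuous_intros)
  have E0: "E s = 0" if "0 < s" "s < e" for s
  proof -
    have s: "0 \<le> s" using that by simp
    have "integral {0..1} (\<lambda>t. s *\<^sub>R ?DD v u (p + t *\<^sub>R s *\<^sub>R v)) = integral {0..1} (\<lambda>t. ?DD (s *\<^sub>R v) u (p + t *\<^sub>R s *\<^sub>R v))"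
      using in_T[OF s that(2)] by (intro integral_cong) (simp add: DDs)
    also have "\<dots> = integral {0..1} (\<lambda>t. ?DD u (s *\<^sub>R v) (p + t *\<^sub>R s *\<^sub>R v))"
      by (rule zero[OF small[OF s that(2)]])
    also have "\<dots> = integral {0..1} (\<lambda>t. s *\<^sub>R ?DD u v (p + t *\<^sub>R s *\<^sub>R v))"
      using in_T[OF s that(2)] by (intro integral_cong) (simp add: DDs)
    finally show ?thesis
      using that int[OF s that(2)] by (simp add: E_def \<kappa>_def integral_diff)
  qed
  have "continuous_on {0..<e} E"
  proof -
    have "continuous_on ({0..<e} \<times> cbox 0 1) (\<lambda>(s, t). \<kappa> (p + t *\<^sub>R s *\<^sub>R v))"
      unfolding split_def
      using in_T by (intro continuous_on_compose2[OF contk]) (auto intro!: continuous_intros)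
    then show ?thesis
      using integral_continuous_on_param[of "{0..<e}" 0 1 "\<lambda>s t. \<kappa> (p + t *\<^sub>R s *\<^sub>R v)"]
      unfolding E_def by (simp add: box_real)
  qed
  then have "(E \<longlongrightarrow> E 0) (at 0 within {0..<e})"
    using e unfolding continuous_on_def by simp
  moreover have "at 0 within {0..<e} = at_right (0::real)"
    using e by (intro at_within_nhd[of 0 "{..<e}"]) auto
  moreover have "\<forall>\<^sub>F s in at_right 0. E s = 0"
    using E0 e eventually_at_right_field by blast
  ultimately have "((\<lambda>_. 0) \<longlongrightarrow> E 0) (at_right (0::real))"
    using Lim_transform_eventually by fastforce
  then have "E 0 = 0" by (simp add: tendsto_const_iff)
  then show ?thesis by (simp add: E_def \<kappa>_def)
qed

text \<open>Both sides are continuous on \<open>S\<close> and agree in the interior, which is dense in \<open>S\<close>.\<close>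

lemma second_derivative_symmetric:
  fixes f :: "'a::euclidean_space \<Rightarrow> 'b::banach"
  assumes S: "region S" and f: "Ck_on (Suc (Suc 0)) S f" and p: "p \<in> S"
  shows "frechet_derivative (\<lambda>x. frechet_derivative f (at x within S) u) (at p within S) v =
         frechet_derivative (\<lambda>x. frechet_derivative f (at x within S) v) (at p within S) u"
proof -
  let ?T = "interior S"
  let ?DD = "\<lambda>S a b x. frechet_derivative (\<lambda>x. frechet_derivative f (at x within S) a) (at x within S) b"
  have ST: "S \<inter> ?T = ?T" using interior_subset by blast
  have fT: "Ck_on (Suc (Suc 0)) ?T f" using Ck_on_Int_open[OF f open_interior, of S] by (simp only: ST)
  have at_eq: "at x within ?T = at x within S" if "x \<in> ?T" for x
    using at_within_Int_open[OF open_interior that, of S] by (simp add: ST)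
  have DD_eq: "?DD ?T a b x = ?DD S a b x" if x: "x \<in> ?T" for a b x
  proof -
    have "?DD ?T a b x = frechet_derivative (\<lambda>x. frechet_derivative f (at x within S) a) (at x within ?T) b"
      using frechet_derivative_cong[OF x, of "\<lambda>x. frechet_derivative f (at x within ?T) a"
          "\<lambda>x. frechet_derivative f (at x within S) a"] at_eq by simp
    then show ?thesis using at_eq[OF x] by simp
  qed
  have sym: "?DD S u v x - ?DD S v u x = 0" if "x \<in> ?T" for x
    using second_derivative_symmetric_open[OF open_interior fT that] DD_eq[OF that] by simp
  have "continuous_on S (\<lambda>x. ?DD S u v x - ?DD S v u x)"
    using Ck_on_frechet_derivative[OF Ck_on_frechet_derivative[OF f]] by (intro continuous_on_diff) simp_all
  then have "closedin (top_of_set S) {x \<in> S. ?DD S u v x - ?DD S v u x = 0}"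
    by (rule continuous_closedin_preimage_constant)
  then obtain K where K: "closed K" "{x \<in> S. ?DD S u v x - ?DD S v u x = 0} = S \<inter> K"
    unfolding closedin_closed by blast
  then have "?T \<subseteq> K" using sym interior_subset[of S] by blast
  then have "p \<in> K"
    using closure_minimal[OF _ K(1)] region_subset_closure_interior[OF S] p by blast
  then have "?DD S u v p - ?DD S v u p = 0" using K(2) p by blast
  then show ?thesis by simp
qed

section \<open>Integration by parts with the weight \<open>1 - t\<close>\<close>

text \<open>The weight \<open>1 - t\<close> vanishes at the right end, so that only the value of \<open>G\<close> at 0 remains.\<close>

lemma integral_by_parts_unit:
  fixes G G' :: "real \<Rightarrow> real"
  assumes G: "\<And>t. t \<in> {0..1} \<Longrightarrow> (G has_real_derivative G' t) (at t within {0..1})"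
    and G': "continuous_on {0..1} G'"
  shows "integral {0..1} (\<lambda>t. (1 - t) * G' t) = integral {0..1} G - G 0"
proof -
  have contG: "continuous_on {0..1} G"
    using G by (rule DERIV_continuous_on)
  have "((\<lambda>t. (1 - t) * G' t - G t) has_integral (1 - 1) * G 1 - (1 - 0) * G 0) {0..1}"
    using G by (intro fundamental_theorem_of_calculus)
      (auto intro!: derivative_eq_intros simp: has_real_derivative_iff_has_vector_derivative[symmetric])
  then have "integral {0..1} (\<lambda>t. (1 - t) * G' t - G t) = - G 0"
    by (simp add: integral_unique)
  moreover have "(\<lambda>t. (1 - t) * G' t) integrable_on {0..1}" "G integrable_on {0..1}"
    using contG G' by (auto intro!: integrable_continuous_interval continuous_intros)
  from integral_diff[OF this]
  have "integral {0..1} (\<lambda>t. (1 - t) * G' t - G t) = integral {0..1} (\<lambda>t. (1 - t) * G' t) - integral {0..1} G" .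
  ultimately show ?thesis by linarith
qed

text \<open>The iterated integral in the definition of \<open>\<lambda>\<close> becomes a single integral, to which differentiation
  under the integral sign applies.\<close>

lemma iterated_integral_unit:
  fixes F :: "real \<Rightarrow> real"
  assumes "continuous_on {0..1} F"
  shows "integral {0..1} (\<lambda>t. integral {0..t} F) = integral {0..1} (\<lambda>t. (1 - t) * F t)"
  using integral_by_parts_unit[of "\<lambda>t. integral {0..t} F" F]
    integral_has_real_derivative[OF assms] assms by simp

section \<open>Bilinear forms with variable coefficients\<close>

lemma bilinear_euclidean_sum:
  fixes B :: "'e::euclidean_space \<Rightarrow> 'e \<Rightarrow> real"
  assumes "bilinear B"
  shows "B a b = (\<Sum>i\<in>Basis. \<Sum>j\<in>Basis. (a \<bullet> i) * (b \<bullet> j) * B i j)"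
proof -
  have "linear (\<lambda>a. B a b)" for b using assms by (simp add: bilinear_def)
  then have "B a b = (\<Sum>i\<in>Basis. (a \<bullet> i) * B i b)"
    using linear_euclidean_sum[of "\<lambda>a. B a b" a] by simp
  also have "\<dots> = (\<Sum>i\<in>Basis. \<Sum>j\<in>Basis. (a \<bullet> i) * (b \<bullet> j) * B i j)"
  proof (rule sum.cong[OF refl])
    fix i :: 'e
    have "linear (B i)" using assms by (simp add: bilinear_def)
    then have "B i b = (\<Sum>j\<in>Basis. (b \<bullet> j) * B i j)"
      using linear_euclidean_sum[of "B i" b] by simp
    then show "(a \<bullet> i) * B i b = (\<Sum>j\<in>Basis. (a \<bullet> i) * (b \<bullet> j) * B i j)"
      by (simp add: sum_distrib_left mult.assoc)
  qed
  finally show ?thesis .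
qed

lemma Ck_on_bilinear_family:
  fixes h :: "'e::euclidean_space \<Rightarrow> 'e \<Rightarrow> 'e \<Rightarrow> real" and S :: "'a::euclidean_space set"
  assumes S: "region S" and E: "open E" and sub: "f ` S \<subseteq> E"
    and bil: "\<And>z. z \<in> E \<Longrightarrow> bilinear (h z)"
    and h: "\<And>a b. Ck_on k E (\<lambda>z. h z a b)"
    and f: "Ck_on k S f" and V: "Ck_on k S V" and W: "Ck_on k S W"
  shows "Ck_on k S (\<lambda>x. h (f x) (V x) (W x))"
proof -
  have "Ck_on k S (\<lambda>x. \<Sum>i\<in>Basis. \<Sum>j\<in>Basis. (V x \<bullet> i) * (W x \<bullet> j) * h (f x) i j)"
  proof (intro Ck_on_sum[OF S] Ck_on_mult[OF S])
    show "Ck_on k S (\<lambda>x. V x \<bullet> i)" "Ck_on k S (\<lambda>x. W x \<bullet> i)" for i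
      by (rule Ck_on_bounded_linear_compose[OF S bounded_linear_inner_left V]
          Ck_on_bounded_linear_compose[OF S bounded_linear_inner_left W])+
    show "Ck_on k S (\<lambda>x. h (f x) i j)" for i j
      by (rule Ck_on_compose[OF S region_open[OF E] sub h f])
  qed
  moreover have "h (f x) (V x) (W x) = (\<Sum>i\<in>Basis. \<Sum>j\<in>Basis. (V x \<bullet> i) * (W x \<bullet> j) * h (f x) i j)"
    if "x \<in> S" for x
  proof -
    have "f x \<in> E" using sub that by blast
    then show ?thesis by (rule bilinear_euclidean_sum[OF bil])
  qed
  ultimately show ?thesis by (rule Ck_on_transform)
qed

text \<open>The product rule for \<open>h (f y) (V y) (W y)\<close>, with only the coefficients \<open>h z a b\<close> for constant \<open>a\<close>, \<open>b\<close>
  assumed to be differentiable: expand in a basis, differentiate, and collect the sums again.\<close>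

lemma has_derivative_bilinear_family:
  fixes h :: "'e::euclidean_space \<Rightarrow> 'e \<Rightarrow> 'e \<Rightarrow> real" and S :: "'a::euclidean_space set"
  assumes E: "open E" and sub: "f ` S \<subseteq> E" and x: "x \<in> S"
    and bil: "\<And>z. z \<in> E \<Longrightarrow> bilinear (h z)"
    and h: "\<And>a b. (\<lambda>z. h z a b) differentiable (at (f x))"
    and f: "(f has_derivative f') (at x within S)"
    and V: "(V has_derivative V') (at x within S)"
    and W: "(W has_derivative W') (at x within S)"
  shows "((\<lambda>y. h (f y) (V y) (W y)) has_derivative
    (\<lambda>u. frechet_derivative (\<lambda>z. h z (V x) (W x)) (at (f x)) (f' u)
        + h (f x) (V' u) (W x) + h (f x) (V x) (W' u))) (at x within S)"
proof -
  define H where "H a b = frechet_derivative (\<lambda>z. h z a b) (at (f x))" for a b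
  have H: "((\<lambda>z. h z a b) has_derivative H a b) (at (f x))" for a b
    using h unfolding H_def by (simp add: frechet_derivative_works)
  have fx: "f x \<in> E" using sub x by blast
  have H_sum: "H a b w = (\<Sum>i\<in>Basis. \<Sum>j\<in>Basis. (a \<bullet> i) * (b \<bullet> j) * H i j w)" for a b w
  proof -
    have "((\<lambda>z. \<Sum>i\<in>Basis. \<Sum>j\<in>Basis. (a \<bullet> i) * (b \<bullet> j) * h z i j) has_derivative
        (\<lambda>w. \<Sum>i\<in>Basis. \<Sum>j\<in>Basis. (a \<bullet> i) * (b \<bullet> j) * H i j w)) (at (f x))"
      by (intro has_derivative_sum has_derivative_mult_right H)
    then have "((\<lambda>z. h z a b) has_derivative
        (\<lambda>w. \<Sum>i\<in>Basis. \<Sum>j\<in>Basis. (a \<bullet> i) * (b \<bullet> j) * H i j w)) (at (f x))"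
      by (rule has_derivative_transform_within_open[OF _ E fx])
        (simp add: bilinear_euclidean_sum[OF bil, symmetric])
    from has_derivative_unique[OF H this] show ?thesis by (rule fun_cong)
  qed
  have "((\<lambda>y. \<Sum>i\<in>Basis. \<Sum>j\<in>Basis. (V y \<bullet> i) * (W y \<bullet> j) * h (f y) i j) has_derivative
      (\<lambda>u. \<Sum>i\<in>Basis. \<Sum>j\<in>Basis. (V x \<bullet> i) * (W x \<bullet> j) * H i j (f' u)
          + ((V x \<bullet> i) * (W' u \<bullet> j) + (V' u \<bullet> i) * (W x \<bullet> j)) * h (f x) i j)) (at x within S)"
    by (intro has_derivative_sum has_derivative_mult has_derivative_inner_left V W
        has_derivative_compose[OF f H])
  then have "((\<lambda>y. h (f y) (V y) (W y)) has_derivative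
      (\<lambda>u. \<Sum>i\<in>Basis. \<Sum>j\<in>Basis. (V x \<bullet> i) * (W x \<bullet> j) * H i j (f' u)
          + ((V x \<bullet> i) * (W' u \<bullet> j) + (V' u \<bullet> i) * (W x \<bullet> j)) * h (f x) i j)) (at x within S)"
  proof (rule has_derivative_transform[OF x, rotated])
    fix y assume "y \<in> S"
    then have "f y \<in> E" using sub by blast
    then show "h (f y) (V y) (W y) = (\<Sum>i\<in>Basis. \<Sum>j\<in>Basis. (V y \<bullet> i) * (W y \<bullet> j) * h (f y) i j)"
      by (rule bilinear_euclidean_sum[OF bil])
  qed
  moreover have "(\<Sum>i\<in>Basis. \<Sum>j\<in>Basis. (V x \<bullet> i) * (W x \<bullet> j) * H i j (f' u)
          + ((V x \<bullet> i) * (W' u \<bullet> j) + (V' u \<bullet> i) * (W x \<bullet> j)) * h (f x) i j)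
      = H (V x) (W x) (f' u) + h (f x) (V' u) (W x) + h (f x) (V x) (W' u)" for u
    unfolding H_sum[of "V x" "W x"] bilinear_euclidean_sum[OF bil[OF fx], of "V' u"]
      bilinear_euclidean_sum[OF bil[OF fx], of "V x"]
    by (simp add: sum.distrib[symmetric] algebra_simps)
  ultimately show ?thesis unfolding H_def by simp
qed

section \<open>Charts and tangent vectors\<close>

lemma smooth_atlas_chart:
  assumes "smooth_atlas X A" "c \<in> A"
  shows "openin X (fst c)" "open (snd c ` fst c)" "inj_on (snd c) (fst c)"
    "homeomorphic_map (subtopology X (fst c)) (top_of_set (snd c ` fst c)) (snd c)"
proof -
  show 1: "openin X (fst c)" "open (snd c ` fst c)"
    and 2: "homeomorphic_map (subtopology X (fst c)) (top_of_set (snd c ` fst c)) (snd c)"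
    using assms unfolding smooth_atlas_def by (auto simp: split_def)
  have "topspace (subtopology X (fst c)) = fst c" using openin_subset[OF 1(1)] by auto
  then show "inj_on (snd c) (fst c)" using homeomorphic_imp_injective_map[OF 2] by simp
qed

lemma chart_inv_chart:
  assumes "smooth_atlas X A" "c \<in> A" "p \<in> fst c"
  shows "chart_inv c (snd c p) = p"
  using smooth_atlas_chart(3)[OF assms(1,2)] assms(3) by (simp add: chart_inv_def)

lemma open_chart_overlap:
  assumes "smooth_atlas X A" "c \<in> A" "c' \<in> A"
  shows "open (snd c ` (fst c \<inter> fst c'))"
proof -
  note c = smooth_atlas_chart[OF assms(1,2)]
  have "openin (subtopology X (fst c)) (fst c \<inter> fst c')"
    using smooth_atlas_chart(1)[OF assms(1,3)] by (auto simp: openin_subtopology)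
  then have "openin (top_of_set (snd c ` fst c)) (snd c ` (fst c \<inter> fst c'))"
    using homeomorphic_imp_open_map[OF c(4)] unfolding open_map_def by blast
  then show ?thesis using c(2) openin_open_trans by blast
qed

lemma jac_has_derivative:
  assumes "smooth_atlas X A" "c \<in> A" "c' \<in> A" "p \<in> fst c" "p \<in> fst c'"
  shows "((snd c' \<circ> chart_inv c) has_derivative jac c c' p) (at (snd c p))"
proof -
  let ?T = "snd c ` (fst c \<inter> fst c')"
  have "smooth_on ?T (snd c' \<circ> chart_inv c)"
    using assms(1-3) unfolding smooth_atlas_def chart_inv_def by (auto simp: split_def)
  then have "Ck_on (Suc 0) ?T (snd c' \<circ> chart_inv c)" by (simp add: smooth_on_def)
  then have "(snd c' \<circ> chart_inv c) differentiable (at (snd c p) within ?T)"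
    using assms(4,5) by simp
  then show ?thesis
    using at_within_open[OF _ open_chart_overlap[OF assms(1-3)], of "snd c p"] assms(4,5)
    by (simp add: jac_def frechet_derivative_works)
qed

text \<open>The chain rule, since the coordinate changes compose.  It makes \<^const>\<open>coord_vec\<close> a tangent vector.\<close>

lemma jac_cocycle:
  assumes A: "smooth_atlas X A" and c: "c \<in> A" "c' \<in> A" "c'' \<in> A"
    and p: "p \<in> fst c" "p \<in> fst c'" "p \<in> fst c''"
  shows "jac c c'' p a = jac c' c'' p (jac c c' p a)"
proof -
  have inv: "chart_inv c (snd c p) = p" by (rule chart_inv_chart[OF A c(1) p(1)])
  have "((\<lambda>z. (snd c'' \<circ> chart_inv c') ((snd c' \<circ> chart_inv c) z)) has_derivative
      (\<lambda>a. jac c' c'' p (jac c c' p a))) (at (snd c p))"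
    using jac_has_derivative[OF A c(2,3) p(2,3)]
    by (intro has_derivative_compose[OF jac_has_derivative[OF A c(1,2) p(1,2)]]) (simp add: inv o_def)
  then have "((snd c'' \<circ> chart_inv c) has_derivative (\<lambda>a. jac c' c'' p (jac c c' p a))) (at (snd c p))"
  proof (rule has_derivative_transform_within_open[OF _ open_chart_overlap[OF A c(1,2)]])
    fix z assume "z \<in> snd c ` (fst c \<inter> fst c')"
    then show "(snd c'' \<circ> chart_inv c') ((snd c' \<circ> chart_inv c) z) = (snd c'' \<circ> chart_inv c) z"
      using chart_inv_chart[OF A c(1)] chart_inv_chart[OF A c(2)] by auto
  qed (use p in auto)
  from has_derivative_unique[OF jac_has_derivative[OF A c(1,3) p(1,3)] this]
  show ?thesis by (rule fun_cong)
qed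

lemma coord_vec_in_tangent_space:
  assumes A: "smooth_atlas X A" and c: "c \<in> charts_at A p"
  shows "coord_vec A c p a \<in> tangent_space A p"
  using c jac_cocycle[OF A] by (auto simp: tangent_space_def coord_vec_def charts_at_def)

text \<open>A tangent vector is determined by its component in one chart; together with \<open>coord_vec_comb\<close> this
  translates statements about a 2-form on tangent spaces into statements about its coefficients.\<close>

lemma tangent_vector_eq_coord_vec:
  assumes "v \<in> tangent_space A p" "c \<in> charts_at A p"
  shows "v = coord_vec A c p (v c)"
proof
  fix c'
  show "v c' = coord_vec A c p (v c) c'"
  proof (cases "c' \<in> charts_at A p")
    case True
    then have "v c' = jac c c' p (v c)" using assms unfolding tangent_space_def by blast
    then show ?thesis using True by (simp add: coord_vec_def)
  next
    case False
    then have "v c' = 0" using assms(1) unfolding tangent_space_def by blast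
    then show ?thesis using False by (simp add: coord_vec_def)
  qed
qed

lemma coord_vec_comb:
  assumes A: "smooth_atlas X A" and c: "c \<in> charts_at A p"
  shows "coord_vec A c p (r *\<^sub>R a + s *\<^sub>R b) = tvec_comb r (coord_vec A c p a) s (coord_vec A c p b)"
proof
  fix c'
  show "coord_vec A c p (r *\<^sub>R a + s *\<^sub>R b) c' = tvec_comb r (coord_vec A c p a) s (coord_vec A c p b) c'"
  proof (cases "c' \<in> charts_at A p")
    case True
    then have "linear (jac c c' p)"
      using c by (intro has_derivative_linear[OF jac_has_derivative[OF A]]) (auto simp: charts_at_def)
    then show ?thesis using True
      by (simp add: coord_vec_def tvec_comb_def linear_add linear_scale)
  qed (simp add: coord_vec_def tvec_comb_def)
qed

lemma chart_form_alternating: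
  assumes A: "smooth_atlas X A" and w: "smooth_2form X A \<omega>" and c: "c \<in> A" and z: "z \<in> snd c ` fst c"
  shows "bilinear (chart_form A \<omega> c z)" "chart_form A \<omega> c z a b = - chart_form A \<omega> c z b a"
proof -
  obtain p where p: "p \<in> fst c" "z = snd c p" using z by blast
  have inv: "chart_inv c z = p" using chart_inv_chart[OF A c p(1)] p(2) by simp
  have cp: "c \<in> charts_at A p" using c p by (simp add: charts_at_def)
  note tan = coord_vec_in_tangent_space[OF A cp]
  have "p \<in> topspace X" using openin_subset[OF smooth_atlas_chart(1)[OF A c]] p by blast
  then have alt: "alt_bilinear_on tvec_comb (tangent_space A p) (\<omega> p)"
    using w unfolding smooth_2form_def by blast
  let ?B = "chart_form A \<omega> c z"
  have B: "?B a b = \<omega> p (coord_vec A c p a) (coord_vec A c p b)" for a b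
    by (simp add: chart_form_def inv)
  have l: "?B (r *\<^sub>R a + s *\<^sub>R a') b = r * ?B a b + s * ?B a' b" for r s a a' b
    using alt tan unfolding B coord_vec_comb[OF A cp] alt_bilinear_on_def linear_form_on_def by blast
  have r: "?B b (r *\<^sub>R a + s *\<^sub>R a') = r * ?B b a + s * ?B b a'" for r s a a' b
    using alt tan unfolding B coord_vec_comb[OF A cp] alt_bilinear_on_def linear_form_on_def by blast
  show "bilinear ?B"
    unfolding bilinear_def
  proof (intro allI conjI)
    show "linear (?B a)" for a
      using r[of a 1 _ 1] r[of a _ _ 0] by (intro linearI) simp_all
    show "linear (\<lambda>a. ?B a b)" for b
      using l[of 1 _ 1 _ b] l[of _ _ 0 _ b] by (intro linearI) simp_all
  qed
  have zero: "?B a a = 0" for a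
    using alt tan unfolding B alt_bilinear_on_def by blast
  have "?B (a + b) (a + b) = ?B a a + ?B a b + ?B b a + ?B b b"
    using l[of 1 a 1 b "a + b"] r[of a 1 a 1 b] r[of b 1 a 1 b] by simp
  then show "?B a b = - ?B b a" by (simp add: zero)
qed

lemma two_form_eq_chart_form:
  assumes A: "smooth_atlas X A" and c: "c \<in> A" "p \<in> fst c"
    and v: "v \<in> tangent_space A p" and w: "w \<in> tangent_space A p"
  shows "\<omega> p v w = chart_form A \<omega> c (snd c p) (v c) (w c)"
proof -
  have "c \<in> charts_at A p" using c by (simp add: charts_at_def)
  note vw = tangent_vector_eq_coord_vec[OF v this] tangent_vector_eq_coord_vec[OF w this]
  show ?thesis by (simp add: chart_form_def chart_inv_chart[OF A c] vw[symmetric])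
qed

section \<open>Smooth maps and pullbacks of 2-forms\<close>

text \<open>Near a point whose image lies in the chart \<open>c\<close>, the domain of \<open>g\<close> may be replaced by a region on which
  the coordinate expression of \<open>g\<close> is defined, without changing derivatives.\<close>

lemma smooth_into_chart_region:
  assumes A: "smooth_atlas X A" and S: "region S" and g: "smooth_into X A S g" and c: "c \<in> A"
  obtains T where "open T" "S \<inter> g -` fst c = S \<inter> T" "region (S \<inter> T)"
    "\<And>k. Ck_on k (S \<inter> T) (snd c \<circ> g)"
proof -
  have "openin (top_of_set S) {x \<in> topspace (top_of_set S). g x \<in> fst c}"
    using g smooth_atlas_chart(1)[OF A c] unfolding smooth_into_def
    by (intro openin_continuous_map_preimage) auto
  moreover have "{x \<in> topspace (top_of_set S). g x \<in> fst c} = S \<inter> g -` fst c" by auto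
  ultimately obtain T where T: "open T" "S \<inter> g -` fst c = S \<inter> T"
    unfolding openin_open by auto
  have "smooth_on (S \<inter> g -` fst c) (snd c \<circ> g)"
    using g c unfolding smooth_into_def by (auto simp: split_def)
  then show ?thesis
    using T region_Int_open[OF S T(1)] by (intro that[of T]) (auto simp: smooth_on_def)
qed

lemma smooth_into_topspace: "smooth_into X A S g \<Longrightarrow> x \<in> S \<Longrightarrow> g x \<in> topspace X"
  unfolding smooth_into_def continuous_map_def by auto

lemma smooth_into_chart_exists:
  assumes A: "smooth_atlas X A" and g: "smooth_into X A S g" and x: "x \<in> S"
  obtains c where "c \<in> A" "g x \<in> fst c"
proof -
  have "topspace X = (\<Union>c\<in>A. fst c)"
    using A unfolding smooth_atlas_def by (auto simp: split_def)
  then show ?thesis using smooth_into_topspace[OF g x] that by blast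
qed

lemma tangent_map_has_derivative:
  assumes A: "smooth_atlas X A" and S: "region S" and g: "smooth_into X A S g"
    and c: "c \<in> A" and x: "x \<in> S" "g x \<in> fst c"
  shows "((snd c \<circ> g) has_derivative (\<lambda>u. tangent_map A S g x u c)) (at x within S)"
proof -
  obtain T where T: "open T" "S \<inter> g -` fst c = S \<inter> T" "Ck_on (Suc 0) (S \<inter> T) (snd c \<circ> g)"
    using smooth_into_chart_region[OF A S g c] by metis
  have xT: "x \<in> S \<inter> T" using T x by blast
  then have "x \<in> T" by simp
  from differentiableI[OF Ck_on_has_derivative[OF T(3) xT]]
  have "(snd c \<circ> g) differentiable (at x within S)"
    by (simp only: at_within_Int_open[OF T(1) \<open>x \<in> T\<close>])
  then show ?thesis
    using c x by (simp add: tangent_map_def charts_at_def frechet_derivative_works)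
qed

lemma tangent_map_eqI:
  assumes A: "smooth_atlas X A" and S: "region S" and x: "x \<in> S"
    and "\<And>c. c \<in> A \<Longrightarrow> g x \<in> fst c \<Longrightarrow> ((snd c \<circ> g) has_derivative (\<lambda>u. V u c)) (at x within S)"
    and "\<And>c. c \<notin> charts_at A (g x) \<Longrightarrow> V u c = 0"
  shows "tangent_map A S g x u = V u"
proof
  fix c
  show "tangent_map A S g x u c = V u c"
    using assms(4,5)[of c] region_frechet_derivative[OF S x, of "snd c \<circ> g"]
    by (auto simp: tangent_map_def charts_at_def)
qed

text \<open>The components in two charts are related by the chain rule for the coordinate change.\<close>

lemma tangent_map_in_tangent_space:
  assumes A: "smooth_atlas X A" and S: "region S" and g: "smooth_into X A S g" and x: "x \<in> S"
  shows "tangent_map A S g x u \<in> tangent_space A (g x)"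
  unfolding tangent_space_def
proof (intro CollectI conjI allI ballI impI)
  show "tangent_map A S g x u c = 0" if "c \<notin> charts_at A (g x)" for c
    using that by (simp add: tangent_map_def)
  fix c c' assume "c \<in> charts_at A (g x)" "c' \<in> charts_at A (g x)"
  then have c: "c \<in> A" "c' \<in> A" "g x \<in> fst c" "g x \<in> fst c'" by (auto simp: charts_at_def)
  obtain T where T: "open T" "S \<inter> g -` fst c = S \<inter> T" "region (S \<inter> T)"
    using smooth_into_chart_region[OF A S g c(1)] by metis
  have xT: "x \<in> S \<inter> T" "x \<in> T" using T x c by blast+
  note at_eq = at_within_Int_open[OF T(1) xT(2), of S]
  have 1: "((snd c \<circ> g) has_derivative (\<lambda>u. tangent_map A S g x u c)) (at x within S \<inter> T)"
    unfolding at_eq by (rule tangent_map_has_derivative[OF A S g c(1) x c(3)])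
  have 2: "((snd c' \<circ> chart_inv c) has_derivative jac c c' (g x)) (at ((snd c \<circ> g) x))"
    unfolding o_apply[of "snd c" g] by (rule jac_has_derivative[OF A c])
  have 3: "(snd c' \<circ> g) y = (snd c' \<circ> chart_inv c) ((snd c \<circ> g) y)" if y: "y \<in> S \<inter> T" for y
  proof -
    have "g y \<in> fst c" using T(2) y by blast
    then show ?thesis by (simp add: chart_inv_chart[OF A c(1)])
  qed
  have 4: "((snd c' \<circ> g) has_derivative (\<lambda>u. jac c c' (g x) (tangent_map A S g x u c))) (at x within S \<inter> T)"
    by (rule has_derivative_transform[OF xT(1) 3 has_derivative_compose[OF 1 2]])
  have 5: "((snd c' \<circ> g) has_derivative (\<lambda>u. tangent_map A S g x u c')) (at x within S \<inter> T)"
    unfolding at_eq by (rule tangent_map_has_derivative[OF A S g c(2) x c(4)])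
  have "(\<lambda>u. tangent_map A S g x u c') = (\<lambda>u. jac c c' (g x) (tangent_map A S g x u c))"
    using region_frechet_derivative[OF T(3) xT(1) 4] region_frechet_derivative[OF T(3) xT(1) 5] by simp
  then show "tangent_map A S g x u c' = jac c c' (g x) (tangent_map A S g x u c)" by (rule fun_cong)
qed

text \<open>For a path these are, up to the values outside the unit interval, its tangent vectors in the path
  space; the differentials of a smooth map in a fixed direction are of the same kind, so that one regularity
  lemma, \<open>smooth_two_form_along\<close>, serves both.\<close>

definition smooth_field_along ::
  "('m, 'e::euclidean_space) chart set \<Rightarrow> 'a::real_normed_vector set \<Rightarrow> ('a \<Rightarrow> 'm) \<Rightarrow>
   ('a \<Rightarrow> ('m, 'e) tvec) \<Rightarrow> bool" where
  "smooth_field_along A S g V \<longleftrightarrow>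
     (\<forall>x\<in>S. V x \<in> tangent_space A (g x)) \<and>
     (\<forall>c\<in>A. smooth_on (S \<inter> g -` fst c) (\<lambda>x. V x c))"

lemma tangent_map_chart_eq:
  assumes T: "open T" "S \<inter> g -` fst c = S \<inter> T" and c: "c \<in> A" and y: "y \<in> S \<inter> T"
  shows "tangent_map A S g y u c = frechet_derivative (snd c \<circ> g) (at y within S \<inter> T) u"
proof -
  have "g y \<in> fst c" using T y by blast
  then show ?thesis
    using c y by (simp add: tangent_map_def charts_at_def at_within_Int_open[OF T(1)])
qed

lemma smooth_field_along_tangent_map:
  assumes A: "smooth_atlas X A" and S: "region S" and g: "smooth_into X A S g"
  shows "smooth_field_along A S g (\<lambda>x. tangent_map A S g x u)"
  unfolding smooth_field_along_def smooth_on_def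
proof (intro conjI ballI allI)
  show "tangent_map A S g x u \<in> tangent_space A (g x)" if "x \<in> S" for x
    by (rule tangent_map_in_tangent_space[OF A S g that])
  fix c k assume c: "c \<in> A"
  obtain T where T: "open T" "S \<inter> g -` fst c = S \<inter> T" "Ck_on (Suc k) (S \<inter> T) (snd c \<circ> g)"
    using smooth_into_chart_region[OF A S g c] by metis
  show "Ck_on k (S \<inter> g -` fst c) (\<lambda>x. tangent_map A S g x u c)"
    unfolding T(2)
    by (rule Ck_on_transform[OF Ck_on_frechet_derivative[OF T(3)] tangent_map_chart_eq[OF T(1,2) c]])
qed

text \<open>Smoothness is local, and in a chart the function is a bilinear form with smooth coefficients, evaluated on
  smooth arguments.\<close>

lemma smooth_two_form_along:
  assumes A: "smooth_atlas X A" and w: "smooth_2form X A \<omega>" and S: "region S"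
    and g: "smooth_into X A S g" and V: "smooth_field_along A S g V" and W: "smooth_field_along A S g W"
  shows "Ck_on k S (\<lambda>x. \<omega> (g x) (V x) (W x))"
proof (rule Ck_on_local)
  fix x assume x: "x \<in> S"
  obtain c where c: "c \<in> A" "g x \<in> fst c" using smooth_into_chart_exists[OF A g x] .
  obtain T where T: "open T" "S \<inter> g -` fst c = S \<inter> T" "region (S \<inter> T)" "Ck_on k (S \<inter> T) (snd c \<circ> g)"
    using smooth_into_chart_region[OF A S g c(1)] by metis
  have "Ck_on k (S \<inter> T) (\<lambda>x. chart_form A \<omega> c ((snd c \<circ> g) x) (V x c) (W x c))"
  proof (rule Ck_on_bilinear_family[OF T(3) smooth_atlas_chart(2)[OF A c(1)]])
    show "(snd c \<circ> g) ` (S \<inter> T) \<subseteq> snd c ` fst c" using T(2) by auto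
    show "bilinear (chart_form A \<omega> c z)" if "z \<in> snd c ` fst c" for z
      by (rule chart_form_alternating(1)[OF A w c(1) that])
    show "Ck_on k (snd c ` fst c) (\<lambda>z. chart_form A \<omega> c z a b)" for a b
      using w c(1) unfolding smooth_2form_def smooth_on_def by blast
    show "Ck_on k (S \<inter> T) (\<lambda>x. V x c)" "Ck_on k (S \<inter> T) (\<lambda>x. W x c)"
      using V W c(1) T(2) unfolding smooth_field_along_def smooth_on_def by auto
  qed (rule T(4))
  moreover have "\<omega> (g y) (V y) (W y) = chart_form A \<omega> c ((snd c \<circ> g) y) (V y c) (W y c)" if y: "y \<in> S \<inter> T" for y
  proof -
    have "g y \<in> fst c" using T(2) y by blast
    moreover have "V y \<in> tangent_space A (g y)" "W y \<in> tangent_space A (g y)"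
      using V W y unfolding smooth_field_along_def by auto
    ultimately show ?thesis using two_form_eq_chart_form[OF A c(1)] by simp
  qed
  ultimately have "Ck_on k (S \<inter> T) (\<lambda>x. \<omega> (g x) (V x) (W x))"
    by (rule Ck_on_transform)
  moreover have "x \<in> T" using T(2) x c by blast
  ultimately show "\<exists>T. open T \<and> x \<in> T \<and> Ck_on k (S \<inter> T) (\<lambda>x. \<omega> (g x) (V x) (W x))" using T(1) by blast
qed

text \<open>In a chart, differentiating \<open>h (f y) (D f y a) (D f y b)\<close>
  yields derivatives of the coefficients, whose alternating sum vanishes by closedness, and terms with second
  derivatives of \<open>f\<close>, which cancel because these are symmetric and \<open>h\<close> is skew.\<close>

lemma pullback_of_closed_2form:
  assumes A: "smooth_atlas X A" and w: "smooth_2form X A \<omega>" and closed: "closed_2form A \<omega>"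
    and S: "region S" and g: "smooth_into X A S g" and x: "x \<in> S"
  defines "\<sigma> \<equiv> \<lambda>a b y. \<omega> (g y) (tangent_map A S g y a) (tangent_map A S g y b)"
  shows "frechet_derivative (\<sigma> b d) (at x within S) a - frechet_derivative (\<sigma> a d) (at x within S) b
    + frechet_derivative (\<sigma> a b) (at x within S) d = 0"
proof -
  obtain c where c: "c \<in> A" "g x \<in> fst c" using smooth_into_chart_exists[OF A g x] .
  obtain T where T: "open T" "S \<inter> g -` fst c = S \<inter> T" "region (S \<inter> T)"
      "Ck_on (Suc (Suc 0)) (S \<inter> T) (snd c \<circ> g)"
    using smooth_into_chart_region[OF A S g c(1)] by metis
  let ?R = "S \<inter> T" and ?f = "snd c \<circ> g" and ?E = "snd c ` fst c" and ?h = "chart_form A \<omega> c"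
  let ?D = "\<lambda>a y. frechet_derivative ?f (at y within ?R) a"
  let ?DD = "\<lambda>a b. frechet_derivative (?D a) (at x within ?R) b"
  have xR: "x \<in> ?R" using T(2) x c by blast
  have fx: "?f x \<in> ?E" using c by auto
  have E: "open ?E" by (rule smooth_atlas_chart(2)[OF A c(1)])
  have bil: "bilinear (?h z)" if "z \<in> ?E" for z
    by (rule chart_form_alternating(1)[OF A w c(1) that])
  have skew: "?h (?f x) a b = - ?h (?f x) b a" for a b
    by (rule chart_form_alternating(2)[OF A w c(1) fx])
  have sigma: "\<sigma> a b y = ?h (?f y) (?D a y) (?D b y)" if y: "y \<in> ?R" for a b y
  proof -
    have "g y \<in> fst c" "y \<in> S" using T(2) y by blast+
    then show ?thesis
      unfolding \<sigma>_def tangent_map_chart_eq[OF T(1,2) c(1) y, symmetric]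
      using two_form_eq_chart_form[OF A c(1)] tangent_map_in_tangent_space[OF A S g] by simp
  qed
  have D\<sigma>: "frechet_derivative (\<sigma> a b) (at x within S) u =
      frechet_derivative (\<lambda>z. ?h z (?D a x) (?D b x)) (at (?f x)) (?D u x)
      + ?h (?f x) (?DD a u) (?D b x) + ?h (?f x) (?D a x) (?DD b u)" for a b u
  proof -
    have "((\<lambda>y. ?h (?f y) (?D a y) (?D b y)) has_derivative
      (\<lambda>u. frechet_derivative (\<lambda>z. ?h z (?D a x) (?D b x)) (at (?f x)) (?D u x)
      + ?h (?f x) (?DD a u) (?D b x) + ?h (?f x) (?D a x) (?DD b u))) (at x within ?R)"
    proof (rule has_derivative_bilinear_family[OF E _ xR bil])
      show "?f ` ?R \<subseteq> ?E" using T(2) by auto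
      show "(\<lambda>z. ?h z a b) differentiable (at (?f x))" for a b
      proof -
        have "Ck_on (Suc 0) ?E (\<lambda>z. ?h z a b)"
          using w c(1) unfolding smooth_2form_def smooth_on_def by blast
        from differentiableI[OF Ck_on_has_derivative[OF this fx]]
        show ?thesis unfolding at_within_open[OF fx E] .
      qed
      show "(?f has_derivative (\<lambda>u. ?D u x)) (at x within ?R)"
        by (rule Ck_on_has_derivative[OF Ck_on_Suc_imp[OF T(4)] xR])
      show "(?D a has_derivative ?DD a) (at x within ?R)" "(?D b has_derivative ?DD b) (at x within ?R)"
        by (rule Ck_on_has_derivative[OF Ck_on_frechet_derivative[OF T(4)] xR])+
    qed
    then have "(\<sigma> a b has_derivative
      (\<lambda>u. frechet_derivative (\<lambda>z. ?h z (?D a x) (?D b x)) (at (?f x)) (?D u x)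
      + ?h (?f x) (?DD a u) (?D b x) + ?h (?f x) (?D a x) (?DD b u))) (at x within ?R)"
      by (rule has_derivative_transform[OF xR, rotated]) (rule sigma)
    from region_frechet_derivative[OF T(3) xR this] show ?thesis
      using xR by (simp add: at_within_Int_open[OF T(1)])
  qed
  have sym: "?DD a b = ?DD b a" for a b
    by (rule second_derivative_symmetric[OF T(3,4) xR])
  have cl: "frechet_derivative (\<lambda>z. ?h z (?D b x) (?D d x)) (at (?f x)) (?D a x)
      - frechet_derivative (\<lambda>z. ?h z (?D a x) (?D d x)) (at (?f x)) (?D b x)
      + frechet_derivative (\<lambda>z. ?h z (?D a x) (?D b x)) (at (?f x)) (?D d x) = 0"
    using closed c(1) fx unfolding closed_2form_def by blast
  show ?thesis
    unfolding D\<sigma>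
    using cl sym[of a b] sym[of a d] sym[of b d] skew[of "?D b x" "?DD d a"] by simp
qed

section \<open>The forms on the path space\<close>

lemma region_unit_interval: "region {0..1::real}"
  by (rule region_convex) auto

lemma path_space_smooth_into: "\<gamma> \<in> path_space X A \<Longrightarrow> smooth_into X A {0..1} \<gamma>"
  by (simp add: path_space_def)

lemma path_tangent_smooth_field: "V \<in> path_tangent A \<gamma> \<Longrightarrow> smooth_field_along A {0..1} \<gamma> V"
  by (simp add: path_tangent_def smooth_field_along_def)

lemma two_form_along_path_continuous:
  assumes A: "smooth_atlas X A" and w: "smooth_2form X A \<omega>" and g: "\<gamma> \<in> path_space X A"
    and V: "smooth_field_along A {0..1} \<gamma> V" and W: "smooth_field_along A {0..1} \<gamma> W"
  shows "continuous_on {0..1} (\<lambda>t. \<omega> (\<gamma> t) (V t) (W t))"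
  using smooth_two_form_along[OF A w region_unit_interval path_space_smooth_into[OF g] V W]
  by (rule Ck_on_imp_continuous_on)

text \<open>Replacing the integrand by \<open>F\<close> on the unit interval allows \<open>F\<close> to be the pullback along a plot.\<close>

lemma path_lambda_weighted:
  assumes F: "continuous_on {0..1} F"
    and eq: "\<And>t. t \<in> {0..1} \<Longrightarrow> \<omega> (\<gamma> t) (velocity A \<gamma> t) (V t) = F t"
  shows "path_lambda A \<omega> \<gamma> V = integral {0..1} (\<lambda>t. (1 - t) * F t)"
proof -
  have "path_lambda A \<omega> \<gamma> V = integral {0..1} (\<lambda>t. integral {0..t} F)"
    unfolding path_lambda_def d_ev_def by (intro integral_cong) (simp add: eq)
  then show ?thesis by (simp add: iterated_integral_unit[OF F])
qed

lemma smooth_2form_on_path: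
  assumes w: "smooth_2form X A \<omega>" and g: "\<gamma> \<in> path_space X A" and t: "t \<in> {0..1}"
  shows "alt_bilinear_on tvec_comb (tangent_space A (\<gamma> t)) (\<omega> (\<gamma> t))"
  using w smooth_into_topspace[OF path_space_smooth_into[OF g] t] unfolding smooth_2form_def by blast

lemma path_lambda_linear:
  assumes A: "smooth_atlas X A" and w: "smooth_2form X A \<omega>" and g: "\<gamma> \<in> path_space X A"
  shows "linear_form_on path_tvec_comb (path_tangent A \<gamma>) (path_lambda A \<omega> \<gamma>)"
  unfolding linear_form_on_def
proof (intro ballI allI)
  fix V W r s assume V: "V \<in> path_tangent A \<gamma>" and W: "W \<in> path_tangent A \<gamma>"
  let ?F = "\<lambda>V t. \<omega> (\<gamma> t) (velocity A \<gamma> t) (V t)"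
  have vel: "smooth_field_along A {0..1} \<gamma> (velocity A \<gamma>)"
    using smooth_field_along_tangent_map[OF A region_unit_interval path_space_smooth_into[OF g], of 1]
    unfolding velocity_def .
  have cont: "continuous_on {0..1} (?F V)" "continuous_on {0..1} (?F W)"
    by (rule two_form_along_path_continuous[OF A w g vel path_tangent_smooth_field] V W)+
  have comb: "?F (path_tvec_comb r V s W) t = r * ?F V t + s * ?F W t" if t: "t \<in> {0..1}" for t
  proof -
    have "V t \<in> tangent_space A (\<gamma> t)" "W t \<in> tangent_space A (\<gamma> t)"
        "velocity A \<gamma> t \<in> tangent_space A (\<gamma> t)"
      using V W vel t unfolding path_tangent_def smooth_field_along_def by blast+
    then show ?thesis
      using smooth_2form_on_path[OF w g t]
      unfolding path_tvec_comb_def alt_bilinear_on_def linear_form_on_def by blast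
  qed
  have int: "(\<lambda>t. (1 - t) * ?F V t) integrable_on {0..1}" "(\<lambda>t. (1 - t) * ?F W t) integrable_on {0..1}"
    by (intro integrable_continuous_interval continuous_on_mult cont continuous_intros)+
  have lam: "path_lambda A \<omega> \<gamma> V = integral {0..1} (\<lambda>t. (1 - t) * ?F V t)" if "continuous_on {0..1} (?F V)" for V
    by (rule path_lambda_weighted[OF that]) (rule refl)
  have "path_lambda A \<omega> \<gamma> (path_tvec_comb r V s W)
      = integral {0..1} (\<lambda>t. (1 - t) * (r * ?F V t + s * ?F W t))"
  proof (rule path_lambda_weighted)
    show "continuous_on {0..1} (\<lambda>t. r * ?F V t + s * ?F W t)" by (intro continuous_intros cont)
  qed (rule comb)
  also have "\<dots> = integral {0..1} (\<lambda>t. r * ((1 - t) * ?F V t) + s * ((1 - t) * ?F W t))"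
    by (simp add: algebra_simps)
  also have "\<dots> = r * integral {0..1} (\<lambda>t. (1 - t) * ?F V t) + s * integral {0..1} (\<lambda>t. (1 - t) * ?F W t)"
    using integral_add[OF integrable_on_cmult_left[OF int(1)] integrable_on_cmult_left[OF int(2)], of r s]
    by simp
  finally show "path_lambda A \<omega> \<gamma> (path_tvec_comb r V s W) = r * path_lambda A \<omega> \<gamma> V + s * path_lambda A \<omega> \<gamma> W"
    unfolding lam[OF cont(1)] lam[OF cont(2)] .
qed

text \<open>The candidate for \<open>d\<lambda>\<close>, defined on all tangent vectors of the path space, not only on those that come
  from plots.\<close>

definition path_omega_minus_ev0 ::
  "('m \<Rightarrow> ('m, 'e) tvec \<Rightarrow> ('m, 'e) tvec \<Rightarrow> real) \<Rightarrow> ('m, 'e) path_form2" where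
  "path_omega_minus_ev0 \<omega> \<gamma> V W = path_omega \<omega> \<gamma> V W - ev_pullback 0 \<omega> \<gamma> V W"

lemma path_omega_minus_ev0_alt_bilinear:
  assumes A: "smooth_atlas X A" and w: "smooth_2form X A \<omega>" and g: "\<gamma> \<in> path_space X A"
  shows "alt_bilinear_on path_tvec_comb (path_tangent A \<gamma>) (path_omega_minus_ev0 \<omega> \<gamma>)"
proof -
  let ?F = "\<lambda>V W t. \<omega> (\<gamma> t) (V t) (W t)" and ?T = "path_tangent A \<gamma>"
  have beta: "path_omega_minus_ev0 \<omega> \<gamma> V W = integral {0..1} (?F V W) - ?F V W 0" for V W
    by (simp add: path_omega_minus_ev0_def path_omega_def ev_pullback_def d_ev_def ev_def)
  have int: "?F V W integrable_on {0..1}" if "V \<in> ?T" "W \<in> ?T" for V W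
    using that by (intro integrable_continuous_interval two_form_along_path_continuous[OF A w g]
        path_tangent_smooth_field)
  have tan: "V t \<in> tangent_space A (\<gamma> t)" if "V \<in> ?T" "t \<in> {0..1}" for V t
    using that unfolding path_tangent_def by blast
  note alt = smooth_2form_on_path[OF w g, unfolded alt_bilinear_on_def linear_form_on_def]
  have zero: "?F V V t = 0" if "V \<in> ?T" "t \<in> {0..1}" for V t
    using alt[OF that(2)] tan[OF that] by blast
  have left: "?F (path_tvec_comb r V s V') W t = r * ?F V W t + s * ?F V' W t"
    if "V \<in> ?T" "V' \<in> ?T" "W \<in> ?T" "t \<in> {0..1}" for r s V V' W t
    using alt[OF that(4)] tan[OF _ that(4)] that unfolding path_tvec_comb_def by blast
  have right: "?F W (path_tvec_comb r V s V') t = r * ?F W V t + s * ?F W V' t"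
    if "V \<in> ?T" "V' \<in> ?T" "W \<in> ?T" "t \<in> {0..1}" for r s V V' W t
    using alt[OF that(4)] tan[OF _ that(4)] that unfolding path_tvec_comb_def by blast
  have int_comb: "integral {0..1} (\<lambda>t. r * f t + s * g t) = r * integral {0..1} f + s * integral {0..1} g"
    if "f integrable_on {0..1}" "g integrable_on {0..1}" for r s and f g :: "real \<Rightarrow> real"
    using integral_add[OF integrable_on_cmult_left[OF that(1)] integrable_on_cmult_left[OF that(2)], of r s]
    by simp
  show ?thesis
    unfolding alt_bilinear_on_def linear_form_on_def
  proof (intro conjI ballI allI)
    fix V assume V: "V \<in> ?T"
    have "integral {0..1} (?F V V) = integral {0..1} (\<lambda>_::real. 0)"
      by (rule integral_cong) (rule zero[OF V])
    then show "path_omega_minus_ev0 \<omega> \<gamma> V V = 0" unfolding beta using zero[OF V, of 0] by simp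
  next
    fix W V V' r s assume T: "W \<in> ?T" "V \<in> ?T" "V' \<in> ?T"
    have "integral {0..1} (?F (path_tvec_comb r V s V') W) = integral {0..1} (\<lambda>t. r * ?F V W t + s * ?F V' W t)"
      by (intro integral_cong left T)
    then show "path_omega_minus_ev0 \<omega> \<gamma> (path_tvec_comb r V s V') W
        = r * path_omega_minus_ev0 \<omega> \<gamma> V W + s * path_omega_minus_ev0 \<omega> \<gamma> V' W"
      unfolding beta int_comb[OF int[OF T(2,1)] int[OF T(3,1)]] left[OF T(2,3,1), of 0, simplified]
      by (simp add: algebra_simps)
  next
    fix W V V' r s assume T: "W \<in> ?T" "V \<in> ?T" "V' \<in> ?T"
    have "integral {0..1} (?F W (path_tvec_comb r V s V')) = integral {0..1} (\<lambda>t. r * ?F W V t + s * ?F W V' t)"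
      by (intro integral_cong right T)
    then show "path_omega_minus_ev0 \<omega> \<gamma> W (path_tvec_comb r V s V')
        = r * path_omega_minus_ev0 \<omega> \<gamma> W V + s * path_omega_minus_ev0 \<omega> \<gamma> W V'"
      unfolding beta int_comb[OF int[OF T(1,2)] int[OF T(1,3)]] right[OF T(2,3,1), of 0, simplified]
      by (simp add: algebra_simps)
  qed
qed

section \<open>Pullbacks along plots\<close>

text \<open>The function \<open>G(a, b)\<close>: the pullback of \<open>\<omega>\<close> by the adjoint map of the plot, on constant vector fields.\<close>

definition plot_pullback_two_form ::
  "('m, 'e::euclidean_space) chart set \<Rightarrow> ('m \<Rightarrow> ('m, 'e) tvec \<Rightarrow> ('m, 'e) tvec \<Rightarrow> real) \<Rightarrow>
   'u::euclidean_space set \<Rightarrow> ('u \<Rightarrow> real \<Rightarrow> 'm) \<Rightarrow> 'u \<times> real \<Rightarrow> 'u \<times> real \<Rightarrow> 'u \<times> real \<Rightarrow> real" where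
  "plot_pullback_two_form A \<omega> U \<phi> a b z =
     \<omega> (case z of (x, t) \<Rightarrow> \<phi> x t)
       (tangent_map A (U \<times> {0..1}) (\<lambda>(x, t). \<phi> x t) z a)
       (tangent_map A (U \<times> {0..1}) (\<lambda>(x, t). \<phi> x t) z b)"

lemma path_plotD:
  assumes "path_plot X A U \<phi>"
  shows "convex U" "interior U \<noteq> {}" "region U" "region (U \<times> {0..1::real})"
    "smooth_into X A (U \<times> {0..1}) (\<lambda>(x, t). \<phi> x t)"
  using assms unfolding path_plot_def by (auto intro: region_convex region_Times_interval)

text \<open>A tangent vector of the plot is a partial derivative of the adjoint map: the derivative within \<open>U\<close> at fixed
  time is the restriction of the derivative within \<open>U \<times> {0..1}\<close>, also at boundary points.\<close>

lemma plot_deriv_eq_tangent_map: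
  assumes A: "smooth_atlas X A" and \<phi>: "path_plot X A U \<phi>" and x: "x \<in> U" and t: "t \<in> {0..1}"
  shows "plot_deriv A U \<phi> x u t = tangent_map A (U \<times> {0..1}) (\<lambda>(x, t). \<phi> x t) (x, t) (u, 0)"
proof -
  note p = path_plotD[OF \<phi>]
  have "tangent_map A U (\<lambda>y. \<phi> y t) x u = tangent_map A (U \<times> {0..1}) (\<lambda>(x, t). \<phi> x t) (x, t) (u, 0)"
  proof (rule tangent_map_eqI[OF A p(3) x])
    fix c assume c: "c \<in> A" "\<phi> x t \<in> fst c"
    have "((snd c \<circ> (\<lambda>(x, t). \<phi> x t)) has_derivative
        (\<lambda>h. tangent_map A (U \<times> {0..1}) (\<lambda>(x, t). \<phi> x t) (x, t) h c)) (at (x, t) within U \<times> {0..1})"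
      using c x t by (intro tangent_map_has_derivative[OF A p(4,5)]) auto
    from has_derivative_slice_fst[OF this t]
    show "((snd c \<circ> (\<lambda>y. \<phi> y t)) has_derivative
        (\<lambda>u. tangent_map A (U \<times> {0..1}) (\<lambda>(x, t). \<phi> x t) (x, t) (u, 0) c)) (at x within U)"
      by (simp add: o_def)
  qed (simp add: tangent_map_def)
  then show ?thesis using t by (simp add: plot_deriv_def)
qed

lemma velocity_plot_eq_tangent_map:
  assumes A: "smooth_atlas X A" and \<phi>: "path_plot X A U \<phi>" and x: "x \<in> U" and t: "t \<in> {0..1}"
  shows "velocity A (\<phi> x) t = tangent_map A (U \<times> {0..1}) (\<lambda>(x, t). \<phi> x t) (x, t) (0, 1)"
proof -
  note p = path_plotD[OF \<phi>]
  have "tangent_map A {0..1} (\<phi> x) t 1 = tangent_map A (U \<times> {0..1}) (\<lambda>(x, t). \<phi> x t) (x, t) (0, 1)"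
  proof (rule tangent_map_eqI[OF A region_unit_interval t,
        where V = "\<lambda>s. tangent_map A (U \<times> {0..1}) (\<lambda>(x, t). \<phi> x t) (x, t) (0, s)"])
    fix c assume c: "c \<in> A" "\<phi> x t \<in> fst c"
    have "((snd c \<circ> (\<lambda>(x, t). \<phi> x t)) has_derivative
        (\<lambda>h. tangent_map A (U \<times> {0..1}) (\<lambda>(x, t). \<phi> x t) (x, t) h c)) (at (x, t) within U \<times> {0..1})"
      using c x t by (intro tangent_map_has_derivative[OF A p(4,5)]) auto
    from has_derivative_slice_snd[OF this x]
    show "((snd c \<circ> \<phi> x) has_derivative
        (\<lambda>s. tangent_map A (U \<times> {0..1}) (\<lambda>(x, t). \<phi> x t) (x, t) (0, s) c)) (at t within {0..1})"
      by (simp add: o_def)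
  qed (simp add: tangent_map_def)
  then show ?thesis by (simp add: velocity_def)
qed

lemma plot_pullback_two_form_smooth:
  assumes A: "smooth_atlas X A" and w: "smooth_2form X A \<omega>" and \<phi>: "path_plot X A U \<phi>"
  shows "Ck_on k (U \<times> {0..1}) (plot_pullback_two_form A \<omega> U \<phi> a b)"
  using smooth_two_form_along[OF A w path_plotD(4,5)[OF \<phi>]
      smooth_field_along_tangent_map[OF A path_plotD(4,5)[OF \<phi>], of a]
      smooth_field_along_tangent_map[OF A path_plotD(4,5)[OF \<phi>], of b]]
  unfolding plot_pullback_two_form_def[abs_def] .

lemma plot_pullback_two_form_slice:
  assumes A: "smooth_atlas X A" and w: "smooth_2form X A \<omega>" and \<phi>: "path_plot X A U \<phi>" and x: "x \<in> U"
  shows "continuous_on {0..1} (\<lambda>t. plot_pullback_two_form A \<omega> U \<phi> a b (x, t))"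
  using x by (intro continuous_on_compose2[OF Ck_on_imp_continuous_on[OF
        plot_pullback_two_form_smooth[OF A w \<phi>]]]) (auto intro!: continuous_intros)

lemma plot_pullback1_path_lambda:
  assumes A: "smooth_atlas X A" and w: "smooth_2form X A \<omega>" and \<phi>: "path_plot X A U \<phi>" and x: "x \<in> U"
  shows "plot_pullback1 A U \<phi> (path_lambda A \<omega>) x u =
    integral {0..1} (\<lambda>t. (1 - t) * plot_pullback_two_form A \<omega> U \<phi> (0, 1) (u, 0) (x, t))"
  unfolding plot_pullback1_def
proof (rule path_lambda_weighted[OF plot_pullback_two_form_slice[OF A w \<phi> x]])
  fix t :: real assume t: "t \<in> {0..1}"
  show "\<omega> (\<phi> x t) (velocity A (\<phi> x) t) (plot_deriv A U \<phi> x u t) =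
      plot_pullback_two_form A \<omega> U \<phi> (0, 1) (u, 0) (x, t)"
    unfolding plot_deriv_eq_tangent_map[OF A \<phi> x t] velocity_plot_eq_tangent_map[OF A \<phi> x t]
      plot_pullback_two_form_def by simp
qed

lemma plot_pullback2_path_omega_minus_ev0:
  assumes A: "smooth_atlas X A" and w: "smooth_2form X A \<omega>" and \<phi>: "path_plot X A U \<phi>" and x: "x \<in> U"
  shows "plot_pullback2 A U \<phi> (path_omega_minus_ev0 \<omega>) x u v =
    integral {0..1} (\<lambda>t. plot_pullback_two_form A \<omega> U \<phi> (u, 0) (v, 0) (x, t))
    - plot_pullback_two_form A \<omega> U \<phi> (u, 0) (v, 0) (x, 0)"
proof -
  have eq: "\<omega> (\<phi> x t) (plot_deriv A U \<phi> x u t) (plot_deriv A U \<phi> x v t) =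
      plot_pullback_two_form A \<omega> U \<phi> (u, 0) (v, 0) (x, t)" if t: "t \<in> {0..1}" for t
    unfolding plot_deriv_eq_tangent_map[OF A \<phi> x t] plot_pullback_two_form_def by simp
  have "integral {0..1} (\<lambda>t. \<omega> (\<phi> x t) (plot_deriv A U \<phi> x u t) (plot_deriv A U \<phi> x v t)) =
      integral {0..1} (\<lambda>t. plot_pullback_two_form A \<omega> U \<phi> (u, 0) (v, 0) (x, t))"
    by (intro integral_cong eq)
  then show ?thesis
    using eq[of 0]
    by (simp add: plot_pullback2_def path_omega_minus_ev0_def path_omega_def ev_pullback_def d_ev_def ev_def)
qed

lemma weighted_pullback_smooth:
  assumes A: "smooth_atlas X A" and w: "smooth_2form X A \<omega>" and \<phi>: "path_plot X A U \<phi>"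
  shows "Ck_on k (U \<times> {0..1}) (\<lambda>z. (1 - snd z) * plot_pullback_two_form A \<omega> U \<phi> a b z)"
  by (intro Ck_on_mult Ck_on_diff Ck_on_const Ck_on_bounded_linear bounded_linear_snd
      path_plotD(4)[OF \<phi>] plot_pullback_two_form_smooth[OF A w \<phi>])

lemma path_lambda_path_1form:
  assumes A: "smooth_atlas X A" and w: "smooth_2form X A \<omega>"
  shows "path_1form X A TYPE('u::euclidean_space) (path_lambda A \<omega>)"
  unfolding path_1form_def smooth_on_def
proof (intro conjI ballI allI impI)
  show "linear_form_on path_tvec_comb (path_tangent A \<gamma>) (path_lambda A \<omega> \<gamma>)" if "\<gamma> \<in> path_space X A" for \<gamma>
    by (rule path_lambda_linear[OF A w that])
  fix U :: "'u set" and \<phi> u k assume \<phi>: "path_plot X A U \<phi>"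
  show "Ck_on k U (\<lambda>x. plot_pullback1 A U \<phi> (path_lambda A \<omega>) x u)"
    by (rule Ck_on_transform[OF Ck_on_integral_parameter[OF path_plotD(1,2)[OF \<phi>] weighted_pullback_smooth[OF A w \<phi>]]])
      (simp add: plot_pullback1_path_lambda[OF A w \<phi>])
qed

lemma path_omega_minus_ev0_path_2form:
  assumes A: "smooth_atlas X A" and w: "smooth_2form X A \<omega>"
  shows "path_2form X A TYPE('u::euclidean_space) (path_omega_minus_ev0 \<omega>)"
  unfolding path_2form_def smooth_on_def
proof (intro conjI ballI allI impI)
  show "alt_bilinear_on path_tvec_comb (path_tangent A \<gamma>) (path_omega_minus_ev0 \<omega> \<gamma>)" if "\<gamma> \<in> path_space X A" for \<gamma>
    by (rule path_omega_minus_ev0_alt_bilinear[OF A w that])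
  fix U :: "'u set" and \<phi> u v k assume \<phi>: "path_plot X A U \<phi>"
  note p = path_plotD[OF \<phi>]
  let ?G = "plot_pullback_two_form A \<omega> U \<phi> (u, 0) (v, 0)"
  have G: "Ck_on k (U \<times> {0..1}) ?G" by (rule plot_pullback_two_form_smooth[OF A w \<phi>])
  have "bounded_linear (\<lambda>x::'u. (x, 0::real))"
    by (intro bounded_linear_Pair bounded_linear_ident bounded_linear_zero)
  then have "Ck_on k U (\<lambda>x. ?G (x, 0))"
    by (intro Ck_on_compose[OF p(3,4) _ G] Ck_on_bounded_linear[OF p(3)]) auto
  from Ck_on_diff[OF p(3) Ck_on_integral_parameter[OF p(1,2) G] this]
  show "Ck_on k U (\<lambda>x. plot_pullback2 A U \<phi> (path_omega_minus_ev0 \<omega>) x u v)"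
    by (rule Ck_on_transform) (simp add: plot_pullback2_path_omega_minus_ev0[OF A w \<phi>])
qed

text \<open>The factor \<open>1 - t\<close> is constant in the directions of \<open>U\<close>, so only the pullback of \<open>\<omega>\<close> is differentiated.\<close>

lemma path_lambda_plot_derivative:
  assumes A: "smooth_atlas X A" and w: "smooth_2form X A \<omega>" and \<phi>: "path_plot X A U \<phi>" and x: "x \<in> U"
  shows "frechet_derivative (\<lambda>y. plot_pullback1 A U \<phi> (path_lambda A \<omega>) y v) (at x within U) u =
    integral {0..1} (\<lambda>t. (1 - t) * frechet_derivative (plot_pullback_two_form A \<omega> U \<phi> (0, 1) (v, 0))
        (at (x, t) within U \<times> {0..1}) (u, 0))"
proof -
  note p = path_plotD[OF \<phi>]
  let ?S = "U \<times> {0..1::real}" and ?G = "plot_pullback_two_form A \<omega> U \<phi> (0, 1) (v, 0)"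
  let ?K = "\<lambda>z. (1 - snd z) * ?G z"
  have G: "Ck_on (Suc 0) ?S ?G" by (rule plot_pullback_two_form_smooth[OF A w \<phi>])
  have "frechet_derivative (\<lambda>y. plot_pullback1 A U \<phi> (path_lambda A \<omega>) y v) (at x within U) =
      frechet_derivative (\<lambda>y. integral {0..1} (\<lambda>t. ?K (y, t))) (at x within U)"
    by (rule frechet_derivative_cong[OF x]) (simp add: plot_pullback1_path_lambda[OF A w \<phi>])
  also have "\<dots> = (\<lambda>u. integral {0..1} (\<lambda>t. frechet_derivative ?K (at (x, t) within ?S) (u, 0)))"
    by (rule region_frechet_derivative[OF p(3) x
          has_derivative_integral_parameter[OF p(1) weighted_pullback_smooth[OF A w \<phi>] x]])
  finally have "frechet_derivative (\<lambda>y. plot_pullback1 A U \<phi> (path_lambda A \<omega>) y v) (at x within U) u =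
      integral {0..1} (\<lambda>t. frechet_derivative ?K (at (x, t) within ?S) (u, 0))"
    by simp
  also have "\<dots> = integral {0..1} (\<lambda>t. (1 - t) * frechet_derivative ?G (at (x, t) within ?S) (u, 0))"
  proof (rule integral_cong)
    fix t :: real assume t: "t \<in> {0..1}"
    have z: "(x, t) \<in> ?S" using x t by simp
    have "((\<lambda>z. 1 - snd z) has_derivative (\<lambda>h. - snd h)) (at (x, t) within ?S)"
      by (auto intro!: derivative_eq_intros)
    from region_frechet_derivative[OF p(4) z has_derivative_mult[OF this Ck_on_has_derivative[OF G z]]]
    show "frechet_derivative ?K (at (x, t) within ?S) (u, 0) =
        (1 - t) * frechet_derivative ?G (at (x, t) within ?S) (u, 0)"
      by simp
  qed
  finally show ?thesis .
qed

text \<open>Closedness of the pullback in the directions \<open>u\<close>, \<open>v\<close> and time turns the difference of the two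
  derivatives into a time derivative, which is integrated by parts.\<close>

lemma path_lambda_ext_deriv:
  assumes A: "smooth_atlas X A" and w: "smooth_2form X A \<omega>" and closed: "closed_2form A \<omega>"
    and \<phi>: "path_plot X A U \<phi>" and x: "x \<in> U"
  shows "plot_pullback2 A U \<phi> (path_omega_minus_ev0 \<omega>) x u v =
    ext_deriv1 U (plot_pullback1 A U \<phi> (path_lambda A \<omega>)) x u v"
proof -
  note p = path_plotD[OF \<phi>]
  let ?S = "U \<times> {0..1::real}" and ?G = "plot_pullback_two_form A \<omega> U \<phi>"
  let ?D = "\<lambda>a b c t. frechet_derivative (?G a b) (at (x, t) within ?S) c"
  have G: "Ck_on (Suc 0) ?S (?G a b)" for a b by (rule plot_pullback_two_form_smooth[OF A w \<phi>])
  have contD: "continuous_on {0..1} (?D a b c)" for a b c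
    using x by (intro continuous_on_compose2[OF Ck_on_imp_continuous_on[OF Ck_on_frechet_derivative[OF G]]])
      (auto intro!: continuous_intros)
  have int: "(\<lambda>t. (1 - t) * ?D a b c t) integrable_on {0..1}" for a b c
    by (intro integrable_continuous_interval continuous_on_mult contD continuous_intros)
  have cl: "?D (0, 1) (v, 0) (u, 0) t - ?D (0, 1) (u, 0) (v, 0) t = ?D (u, 0) (v, 0) (0, 1) t"
    if t: "t \<in> {0..1}" for t
    using pullback_of_closed_2form[OF A w closed p(4,5), of "(x, t)" "(u, 0)" "(v, 0)" "(0, 1)"] x t
    unfolding plot_pullback_two_form_def[abs_def] by simp
  have slice: "((\<lambda>t. ?G (u, 0) (v, 0) (x, t)) has_real_derivative ?D (u, 0) (v, 0) (0, 1) t) (at t within {0..1})"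
    if t: "t \<in> {0..1}" for t
  proof -
    have z: "(x, t) \<in> ?S" using x t by simp
    note d = Ck_on_has_derivative[OF G z, of "(u, 0)" "(v, 0)"]
    have "?D (u, 0) (v, 0) (0, s) t = ?D (u, 0) (v, 0) (0, 1) t * s" for s
      using linear_scale[OF has_derivative_linear[OF d], of s "(0, 1)"] by (simp add: mult.commute)
    then have "(\<lambda>s. ?D (u, 0) (v, 0) (0, s) t) = (*) (?D (u, 0) (v, 0) (0, 1) t)" by (rule ext)
    with has_derivative_slice_snd[OF d x] show ?thesis
      by (simp only: has_field_derivative_def)
  qed
  have "ext_deriv1 U (plot_pullback1 A U \<phi> (path_lambda A \<omega>)) x u v =
      integral {0..1} (\<lambda>t. (1 - t) * ?D (0, 1) (v, 0) (u, 0) t)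
      - integral {0..1} (\<lambda>t. (1 - t) * ?D (0, 1) (u, 0) (v, 0) t)"
    unfolding ext_deriv1_def path_lambda_plot_derivative[OF A w \<phi> x] ..
  also have "\<dots> = integral {0..1} (\<lambda>t. (1 - t) * ?D (0, 1) (v, 0) (u, 0) t - (1 - t) * ?D (0, 1) (u, 0) (v, 0) t)"
    by (rule integral_diff[OF int int, symmetric])
  also have "\<dots> = integral {0..1} (\<lambda>t. (1 - t) * ?D (u, 0) (v, 0) (0, 1) t)"
    by (intro integral_cong) (simp only: right_diff_distrib[symmetric] cl)
  also have "\<dots> = integral {0..1} (\<lambda>t. ?G (u, 0) (v, 0) (x, t)) - ?G (u, 0) (v, 0) (x, 0)"
    by (rule integral_by_parts_unit[OF slice contD])
  also have "\<dots> = plot_pullback2 A U \<phi> (path_omega_minus_ev0 \<omega>) x u v"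
    by (rule plot_pullback2_path_omega_minus_ev0[OF A w \<phi> x, symmetric])
  finally show ?thesis ..
qed

theorem lemma4p1:
  fixes X :: "'m topology"
    and A :: "('m, 'e::euclidean_space) chart set"
    and \<omega> :: "'m \<Rightarrow> ('m, 'e) tvec \<Rightarrow> ('m, 'e) tvec \<Rightarrow> real"
  assumes "symplectic_manifold X A \<omega>"
    and "compact_space X"
    and "connected_space X"
  shows "path_1form X A TYPE('u::euclidean_space) (path_lambda A \<omega>)
    \<and> (\<exists>dlam. is_path_ext_deriv X A TYPE('u) (path_lambda A \<omega>) dlam
         \<and> (\<forall>\<gamma>\<in>path_space X A. \<forall>V\<in>path_tangent A \<gamma>. \<forall>W\<in>path_tangent A \<gamma>.
              path_omega \<omega> \<gamma> V W = ev_pullback 0 \<omega> \<gamma> V W + dlam \<gamma> V W))"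
proof -
  have A: "smooth_atlas X A" and w: "smooth_2form X A \<omega>" and closed: "closed_2form A \<omega>"
    using assms(1) by (simp_all add: symplectic_manifold_def smooth_manifold_def)
  have "is_path_ext_deriv X A TYPE('u) (path_lambda A \<omega>) (path_omega_minus_ev0 \<omega>)"
    unfolding is_path_ext_deriv_def
    using path_lambda_path_1form[OF A w] path_omega_minus_ev0_path_2form[OF A w]
      path_lambda_ext_deriv[OF A w closed] by blast
  then show ?thesis
    using path_lambda_path_1form[OF A w] by (auto simp: path_omega_minus_ev0_def)
qed

end
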